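(* Fix $\epsilon>0$. Let $(G,\Omega)$ be a regular permutation group with minimal faithful permutation degree $\mu=\mu(G)$. Then $$\left|B(H;G,\Omega)\right|\ll H^{\mu+1+\epsilon}.$$
   Context: The height of $f=\sum_i a_ix^i\in\mathbb{Z}[x]$ is $H(f)=\max_i|a_i|$. For $n\in\mathbb{N}$ and real $H\ge 1$, $B_n(H)=\{f\in\mathbb{Z}[x]: f\text{ monic},\ \deg f=n,\ H(f)\le H\}$. For separable $f$, $\Omega_f=\{\alpha\in\mathbb{C}:f(\alpha)=0\}$ and $G_f=\mathrm{Gal}(\mathbb{Q}(\Omega_f)/\mathbb{Q})$, which acts naturally (faithfully) on $\Omega_f$. A permutation group $(G,\Omega)$ is a finite group $G$ with a faithful action on a finite set $\Omega$; it is regular if the action is transitive and $|G|=|\Omega|$. An isomorphism $(G_1,\Omega_1)\cong(G_2,\Omega_2)$ is a pair $(\varphi,\varphi^* )$ of a group isomorphism $\varphi:G_1\to G_2$ and a bijection $\varphi^*:\Omega_1\to\Omega_2$ with $\varphi(\sigma)(\varphi^*(\omega))=\varphi^*(\sigma(\omega))$ for all $\sigma\in G_1,\omega\in\Omega_1$. Set $B(H;G,\Omega)=\{f\in B_{|\Omega|}(H): f\text{ separable},\ (G_f,\Omega_f)\cong(G,\Omega)\}$. The minimal faithful permutation degree of a finite group $G$ is $\mu(G)=\min\{m\in\mathbb{N}: G\text{ admits a faithful action on an }m\text{-set}\}$, where $\mathbb{N}=\{1,2,\dots\}$. The notation $X\ll Y$ means that $X\le CY$ for all $H\ge1$, with $C>0$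 independent of $H$ (it may depend on all the other fixed data). *)

theory Defs
  imports
    Complex_Main
    "HOL-Algebra.Algebraic_Closure_Type"
    "HOL-Algebra.Generated_Fields"
    "HOL-Algebra.Group_Action"
    "HOL-Computational_Algebra.Polynomial"
begin

section \<open>Permutation groups\<close>

text \<open>
  An action of \<open>G\<close> on \<open>E\<close> is, as in the library locale \<^locale>\<open>group_action\<close>, a homomorphism
  \<open>\<phi>\<close> from \<open>G\<close> to the symmetric group of \<open>E\<close>; the permutation group \<open>(G, E)\<close> is the triple
  of \<open>G\<close>, \<open>E\<close> and \<open>\<phi>\<close>.
\<close>

locale perm_group = faithful_action +
  assumes finite_group: "finite (carrier G)"
    and finite_points: "finite E"

locale regular_perm_group = perm_group + transitive_action +
  assumes card_eq: "card (carrier G) = card E"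

definition perm_group_isomorphic ::
  "('a, 'm) monoid_scheme \<Rightarrow> 'b set \<Rightarrow> ('a \<Rightarrow> 'b \<Rightarrow> 'b) \<Rightarrow>
   ('c, 'n) monoid_scheme \<Rightarrow> 'd set \<Rightarrow> ('c \<Rightarrow> 'd \<Rightarrow> 'd) \<Rightarrow> bool" where
  "perm_group_isomorphic G\<^sub>1 \<Omega>\<^sub>1 \<phi>\<^sub>1 G\<^sub>2 \<Omega>\<^sub>2 \<phi>\<^sub>2 \<longleftrightarrow>
     (\<exists>h \<in> iso G\<^sub>1 G\<^sub>2. \<exists>b. bij_betw b \<Omega>\<^sub>1 \<Omega>\<^sub>2 \<and>
        (\<forall>\<sigma> \<in> carrier G\<^sub>1. \<forall>\<omega> \<in> \<Omega>\<^sub>1. \<phi>\<^sub>2 (h \<sigma>) (b \<omega>) = b (\<phi>\<^sub>1 \<sigma> \<omega>)))"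

text \<open>Every finite set is in bijection with a set of naturals, so quantifying over the latter
  is no restriction.\<close>

definition min_faithful_degree :: "('a, 'm) monoid_scheme \<Rightarrow> nat" where
  "min_faithful_degree G =
     (LEAST m. m \<ge> 1 \<and>
        (\<exists>(E :: nat set) \<psi>. finite E \<and> card E = m \<and> faithful_action G E \<psi>))"


section \<open>Integer polynomials and their Galois groups\<close>

definition height :: "int poly \<Rightarrow> int" where
  "height f = Max ((\<lambda>i. \<bar>Polynomial.coeff f i\<bar>) ` {..Polynomial.degree f})"

definition monic_polys :: "nat \<Rightarrow> real \<Rightarrow> int poly set" where
  "monic_polys n H =
     {f. Polynomial.lead_coeff f = 1 \<and> Polynomial.degree f = n \<and> real_of_int (height f) \<le> H}"

definition complex_roots :: "int poly \<Rightarrow> complex set" where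
  "complex_roots f = {\<alpha>. poly (map_poly of_int f) \<alpha> = 0}"

definition separable :: "int poly \<Rightarrow> bool" where
  "separable f \<longleftrightarrow> rsquarefree (map_poly of_int f :: complex poly)"

abbreviation complex_field :: "complex ring" where
  "complex_field \<equiv> ring_of_type_algebra"

definition splitting_field :: "int poly \<Rightarrow> complex ring" where
  "splitting_field f =
     complex_field \<lparr>carrier := generate_field complex_field (\<rat> \<union> complex_roots f)\<rparr>"

text \<open>Automorphisms of the field \<open>L\<close> that fix \<open>K\<close> pointwise, under composition. As for
  \<^const>\<open>AutoGroup\<close>, they are extensional functions on \<open>carrier L\<close>.\<close>

definition Gal :: "('a, 'm) ring_scheme \<Rightarrow> 'a set \<Rightarrow> ('a \<Rightarrow> 'a) monoid" where
  "Gal L K =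
     BijGroup (carrier L)
       \<lparr>carrier := {\<sigma> \<in> ring_iso L L \<inter> Bij (carrier L). \<forall>x \<in> K. \<sigma> x = x}\<rparr>"

definition galois_group :: "int poly \<Rightarrow> (complex \<Rightarrow> complex) monoid" where
  "galois_group f = Gal (splitting_field f) \<rat>"

definition galois_action :: "int poly \<Rightarrow> (complex \<Rightarrow> complex) \<Rightarrow> complex \<Rightarrow> complex" where
  "galois_action f \<sigma> = restrict \<sigma> (complex_roots f)"

definition polys_with_group ::
  "real \<Rightarrow> ('a, 'm) monoid_scheme \<Rightarrow> 'b set \<Rightarrow> ('a \<Rightarrow> 'b \<Rightarrow> 'b) \<Rightarrow> int poly set" where
  "polys_with_group H G \<Omega> \<phi> =
     {f \<in> monic_polys (card \<Omega>) H. separable f \<and>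
        perm_group_isomorphic (galois_group f) (complex_roots f) (galois_action f) G \<Omega> \<phi>}"


section \<open>Finiteness\<close>

text \<open>Hence \<^const>\<open>card\<close> of these sets is their true cardinality.\<close>

lemma finite_monic_polys: "finite (monic_polys n H)"
proof -
  let ?A = "{- \<lfloor>H\<rfloor> .. \<lfloor>H\<rfloor>}"
  let ?c = "\<lambda>f :: int poly. map (Polynomial.coeff f) [0..<Suc n]"
  have bound: "\<bar>Polynomial.coeff f i\<bar> \<le> \<lfloor>H\<rfloor>" if f: "f \<in> monic_polys n H" and i: "i \<le> n" for f i
  proof -
    have "\<bar>Polynomial.coeff f i\<bar> \<le> height f"
      unfolding height_def using f i by (intro Max_ge) (auto simp: monic_polys_def)
    moreover have "height f \<le> \<lfloor>H\<rfloor>"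
      using f by (simp add: monic_polys_def le_floor_iff)
    ultimately show ?thesis by simp
  qed
  have "?c ` monic_polys n H \<subseteq> {xs. set xs \<subseteq> ?A \<and> length xs = Suc n}"
  proof
    fix xs assume "xs \<in> ?c ` monic_polys n H"
    then obtain f where f: "f \<in> monic_polys n H" and xs: "xs = ?c f" by blast
    have "Polynomial.coeff f i \<in> ?A" if "i \<le> n" for i
      using bound[OF f that] by (simp add: abs_le_iff)
    then show "xs \<in> {xs. set xs \<subseteq> ?A \<and> length xs = Suc n}"
      unfolding xs by (auto simp del: upt_Suc atLeastAtMost_iff)
  qed
  then have "finite (?c ` monic_polys n H)"
    using finite_lists_length_eq[of ?A "Suc n"] finite_subset by blast
  moreover have "inj_on ?c (monic_polys n H)"
  proof (rule inj_onI)
    fix f g assume f: "f \<in> monic_polys n H" and g: "g \<in> monic_polys n H" and eq: "?c f = ?c g"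
    show "f = g"
    proof (rule poly_eqI)
      fix i
      show "Polynomial.coeff f i = Polynomial.coeff g i"
      proof (cases "i \<le> n")
        case True
        then have "i \<in> set [0..<Suc n]" by (simp del: upt_Suc)
        with eq show ?thesis by (simp only: map_eq_conv)
      next
        case False
        with f g show ?thesis by (simp add: monic_polys_def coeff_eq_0)
      qed
    qed
  qed
  ultimately show ?thesis by (rule finite_imageD)
qed

lemma finite_polys_with_group: "finite (polys_with_group H G \<Omega> \<phi>)"
  by (rule finite_subset[OF _ finite_monic_polys]) (auto simp: polys_with_group_def)

end

theory Submission
  imports Defs "HOL-Computational_Algebra.Fundamental_Theorem_Algebra"
begin

text \<open>
  Let \<open>f\<close> be one of the polynomials to be counted, \<open>n\<close> its degree, \<open>L\<close> its splitting field and
  \<open>\<Gamma>\<close> its Galois group. Regularity means that the \<open>n\<close> conjugates \<open>\<sigma> \<alpha>\<close> (\<open>\<sigma> \<in> \<Gamma>\<close>) of a root \<open>\<alpha>\<close>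
  are distinct and are all the roots, so \<open>f\<close> is determined by \<open>L\<close> together with an algebraic
  integer \<open>\<alpha> \<in> L\<close>. Landau's inequality bounds the Mahler measure
  \<open>\<Prod>\<^sub>\<sigma> max 1 \<bar>\<sigma> \<alpha>\<bar>\<close> by a constant times \<open>H\<close>. The exponent splits as \<open>\<mu>\<close>, for the choice of \<open>L\<close>,
  plus \<open>1 + \<epsilon>\<close>, for the choice of \<open>\<alpha>\<close> once \<open>L\<close> is known.

  \<^bold>\<open>The fields.\<close> Let \<open>\<Gamma>\<close> act faithfully on a set \<open>E\<close> with \<open>\<mu>\<close> elements. In each orbit fix a point
  \<open>r\<close>, and attach to \<open>e = \<tau> r\<close> the number \<open>\<beta>\<^sub>e\<close>, the product of \<open>c - \<tau> \<alpha>\<close> over all \<open>\<tau>\<close> moving \<open>r\<close> to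
  \<open>e\<close>, with \<open>c\<close> a natural number. Then \<open>\<Gamma>\<close> permutes the \<open>\<beta>\<^sub>e\<close> as it permutes the points \<open>e\<close>, so the
  polynomial with roots \<open>\<beta>\<^sub>e\<close>, \<open>e\<close> running through one orbit, has integer coefficients. Every
  conjugate of \<open>\<alpha>\<close> enters exactly one \<open>\<beta>\<^sub>e\<close> of the orbit. Hence this orbit polynomial has Mahler
  measure, and therefore height, at most a constant times \<open>H\<close>, the same order as \<open>f\<close> itself. The
  orbit polynomials together have \<open>\<mu>\<close> free coefficients, which leaves at most a constant times
  \<open>H\<^sup>\<mu>\<close> possibilities. For some \<open>c\<close> below a bound that depends on \<open>n\<close> and \<open>\<mu>\<close> only, the \<open>\<beta>\<^sub>e\<close> are
  distinct within each orbit; faithfulness then shows that only the identity fixes all of them, so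
  that they generate \<open>L\<close>. Thus the orbit polynomials determine \<open>L\<close>
  (\<open>splitting_field_from_orbit_polys\<close>).

  \<^bold>\<open>The elements.\<close> A nonzero algebraic integer of \<open>L\<close> has a conjugate of absolute value at least
  \<open>1\<close>, because its norm is a nonzero integer. So \<open>\<alpha>\<close> is determined by the conjugates \<open>\<sigma> \<alpha>\<close> rounded
  to a fixed precision. As \<open>L\<close> is stable under complex conjugation, rounding the \<open>n\<close> real numbers
  \<open>Re (\<sigma> \<alpha>) + Im (\<sigma> \<alpha>)\<close> suffices, and this turns \<open>\<alpha>\<close> into a vector in \<open>\<int>\<^sup>n\<close> in which the product
  of the nonzero entries is at most a constant times \<open>H\<close>. Rankin's trick bounds the number of such
  vectors by a constant times \<open>H\<close> to the power \<open>1 + \<epsilon>\<close>, uniformly in \<open>L\<close>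
  (\<open>card_polys_with_splitting_field\<close>).

  Three facts from algebra are developed on the way: numbers built by ring operations from
  algebraic integers are integers as soon as they are rational (\<open>integral_ring_exists\<close>), the fixed
  field of \<open>\<Gamma>\<close> is \<open>\<rat>\<close> (\<open>fixed_field_rational\<close>), and a finite subset of \<open>L\<close> that separates the elements of
  \<open>\<Gamma>\<close> generates \<open>L\<close> (\<open>rat_adjoin_eq_if_separates\<close>).
\<close>

section \<open>Rings of algebraic integers\<close>

interpretation int_mod: Modules.module "\<lambda>(n::int) (x::complex). of_int n * x"
  by standard (simp_all add: algebra_simps)

interpretation rat_vs: vector_space "\<lambda>(q::rat) (x::complex). of_rat q * x"
  by standard (simp_all add: algebra_simps of_rat_add of_rat_mult)

interpretation rat_functional: vector_space_pair
  "\<lambda>(q::rat) (x::complex). of_rat q * x" "\<lambda>(q::rat) (x::rat). q * x"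
  by standard (simp_all add: algebra_simps)

lemma rat_functional_exists:
  obtains l :: "complex \<Rightarrow> rat"
  where "\<And>x y. l (x + y) = l x + l y" "\<And>q x. l (of_rat q * x) = q * l x" "l 1 = 1"
proof -
  have "rat_vs.independent {1}"
    by simp
  then obtain l :: "complex \<Rightarrow> rat"
    where l: "Vector_Spaces.linear (\<lambda>(q::rat) (x::complex). of_rat q * x) (\<lambda>q x. q * x) l"
      "\<forall>x\<in>{1}. l x = (\<lambda>_. 1) x"
    using rat_functional.linear_independent_extend[of "{1}" "\<lambda>_. 1"] by blast
  show thesis
    by (rule that[of l]) (use l in \<open>simp_all add: Vector_Spaces.linear_iff\<close>)
qed

lemma rat_in_Ints_if_bounded_denominators:
  fixes q :: rat and D :: int
  assumes "D \<noteq> 0" and D: "\<And>k. of_int D * q ^ k \<in> \<int>"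
  shows "q \<in> \<int>"
proof -
  obtain a b where ab: "q = of_int a / of_int b" "b > 0" "coprime a b"
    by (metis quotient_of_coprime quotient_of_denom_pos quotient_of_div surj_pair)
  have dvd: "b ^ k dvd D" for k
  proof -
    obtain m where "of_int D * q ^ k = of_int m"
      using D[of k] by (auto simp: Ints_def)
    then have "(of_int (D * a ^ k) :: rat) = of_int (m * b ^ k)"
      using ab(2) by (simp add: ab(1) field_simps)
    then have "D * a ^ k = m * b ^ k"
      by (simp only: of_int_eq_iff)
    then have "b ^ k dvd D * a ^ k"
      by simp
    moreover have "coprime (b ^ k) (a ^ k)"
      using ab(3) by (simp add: coprime_commute)
    ultimately show ?thesis
      by (simp add: coprime_dvd_mult_left_iff)
  qed
  have "b = 1"
  proof (rule ccontr)
    assume "b \<noteq> 1"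
    with ab(2) have "b \<ge> 2" by simp
    have "int (nat \<bar>D\<bar>) < 2 ^ nat \<bar>D\<bar>"
      using of_nat_less_two_power by blast
    also have "(2::int) ^ nat \<bar>D\<bar> \<le> b ^ nat \<bar>D\<bar>"
      using \<open>b \<ge> 2\<close> by (intro power_mono) auto
    also have "\<dots> \<le> \<bar>D\<bar>"
      using dvd[of "nat \<bar>D\<bar>"] \<open>D \<noteq> 0\<close> zdvd_imp_le[of _ "\<bar>D\<bar>"] by simp
    finally show False by simp
  qed
  then show ?thesis using ab(1) by simp
qed

lemma common_denominator:
  fixes A :: "rat set"
  assumes "finite A"
  shows "\<exists>D::int. D \<noteq> 0 \<and> (\<forall>q\<in>A. of_int D * q \<in> \<int>)"
  using assms
proof (induction A rule: finite_induct)
  case empty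
  then show ?case by (intro exI[of _ 1]) auto
next
  case (insert q A)
  then obtain D where D: "D \<noteq> 0" "\<forall>q\<in>A. of_int D * q \<in> \<int>" by blast
  obtain a b where ab: "q = of_int a / of_int b" "b > 0"
    by (metis quotient_of_denom_pos quotient_of_div surj_pair)
  have "of_int (D * b) * r \<in> \<int>" if "r \<in> insert q A" for r
  proof (cases "r = q")
    case True
    then have "of_int (D * b) * r = of_int (D * a)" using ab by simp
    then show ?thesis by (simp only: Ints_of_int)
  next
    case False
    then have "of_int D * r \<in> \<int>" using D that by blast
    then have "of_int b * (of_int D * r) \<in> \<int>" by (rule Ints_mult[OF Ints_of_int])
    moreover have "of_int (D * b) * r = of_int b * (of_int D * r)" by simp
    ultimately show ?thesis by (simp only:)
  qed
  then show ?case using D ab by (intro exI[of _ "D * b"]) auto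
qed

text \<open>
  The powers of \<open>x\<close> stay in a finitely generated group \<open>M\<close>. A \<open>\<rat>\<close>-linear functional with value \<open>1\<close>
  at \<open>1\<close> maps \<open>M\<close> into the fractions with one common denominator and maps the powers of the rational
  number \<open>x\<close> to themselves, so the denominators of these powers are bounded.
\<close>
lemma rational_multiplier_in_Ints:
  assumes V: "finite V" "1 \<in> int_mod.span V"
    and x: "x \<in> \<rat>" "\<And>m. m \<in> int_mod.span V \<Longrightarrow> x * m \<in> int_mod.span V"
  shows "x \<in> \<int>"
proof -
  obtain l :: "complex \<Rightarrow> rat" where l: "\<And>x y. l (x + y) = l x + l y"
      "\<And>q x. l (of_rat q * x) = q * l x" "l 1 = 1"
    using rat_functional_exists by blast
  have l0: "l 0 = 0" using l(2)[of 0 0] by simp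
  obtain D :: int where D: "D \<noteq> 0" "\<forall>v\<in>V. of_int D * l v \<in> \<int>"
    using common_denominator[of "l ` V"] V(1) by auto
  have int: "of_int D * l m \<in> \<int>" if "m \<in> int_mod.span V" for m
    using that
  proof (induction rule: int_mod.span_induct_alt)
    case base
    then show ?case by (simp add: l0)
  next
    case (step c v y)
    have "l (of_int c * v + y) = of_int c * l v + l y"
      using l(2)[of "of_int c" v] by (simp add: l(1))
    then have eq: "of_int D * l (of_int c * v + y) = of_int c * (of_int D * l v) + of_int D * l y"
      by (simp only: ring_distribs mult_ac)
    have "of_int c * (of_int D * l v) + of_int D * l y \<in> \<int>"
      using D(2) step(1) by (intro Ints_add[OF Ints_mult[OF Ints_of_int] step(2)]) blast
    then show ?case by (simp only: eq)
  qed
  obtain q where q: "x = of_rat q" using x(1) by (auto elim: Rats_cases)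
  have "of_int D * q ^ k \<in> \<int>" for k
  proof -
    have "x ^ k \<in> int_mod.span V"
      by (induction k) (use V(2) x(2) in simp_all)
    moreover have "l (x ^ k) = q ^ k"
      using l(2)[of "q ^ k" 1] l(3) by (simp add: q of_rat_power)
    ultimately show ?thesis using int[of "x ^ k"] by simp
  qed
  then have "q \<in> \<int>" using rat_in_Ints_if_bounded_denominators D(1) by blast
  then show ?thesis by (auto simp: q Ints_def)
qed

text \<open>
  The powers of \<open>x\<close> lie in a \<open>\<rat>\<close>-vector space of finite dimension.
\<close>
lemma multiplier_algebraic:
  assumes V: "finite V" "1 \<in> int_mod.span V"
    and x: "\<And>m. m \<in> int_mod.span V \<Longrightarrow> x * m \<in> int_mod.span V"
  shows "\<exists>p::rat poly. p \<noteq> 0 \<and> poly (map_poly of_rat p) x = 0"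
proof -
  have sub: "int_mod.span V \<subseteq> rat_vs.span V"
  proof
    fix m assume "m \<in> int_mod.span V"
    then show "m \<in> rat_vs.span V"
    proof (induction rule: int_mod.span_induct_alt)
      case (step c v y)
      have "of_rat (of_int c) * v + y \<in> rat_vs.span V"
        using step by (intro rat_vs.span_add rat_vs.span_scale) (auto intro: rat_vs.span_base)
      then show ?case by simp
    qed (rule rat_vs.span_zero)
  qed
  have pow: "x ^ k \<in> rat_vs.span V" for k
    using sub by (rule subsetD) (induction k, use V(2) x in simp_all)
  define N where "N = card V"
  show ?thesis
  proof (cases "inj_on (\<lambda>i. x ^ i) {..N}")
    case False
    then obtain i j where ij: "i < j" "x ^ i = x ^ j"
      unfolding inj_on_def by (metis linorder_neqE_nat)
    let ?p = "Polynomial.monom 1 j - Polynomial.monom 1 i :: rat poly"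
    have "poly.coeff ?p j = 1" using ij by simp
    then have "?p \<noteq> 0" by (metis coeff_0 zero_neq_one)
    moreover have "map_poly of_rat ?p = (Polynomial.monom 1 j - Polynomial.monom 1 i :: complex poly)"
      by (rule poly_eqI) (auto simp: coeff_map_poly of_rat_diff)
    then have "poly (map_poly of_rat ?p) x = 0" using ij by (simp add: poly_monom)
    ultimately show ?thesis by blast
  next
    case True
    have "rat_vs.dependent ((\<lambda>i. x ^ i) ` {..N})"
    proof (rule ccontr)
      assume "\<not> rat_vs.dependent ((\<lambda>i. x ^ i) ` {..N})"
      from rat_vs.independent_span_bound[OF V(1) this]
      have "card ((\<lambda>i. x ^ i) ` {..N}) \<le> card V" using pow by blast
      then show False using True by (simp add: card_image N_def)
    qed
    then obtain u v where u: "(\<Sum>v\<in>(\<lambda>i. x ^ i) ` {..N}. of_rat (u v) * v) = 0"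
        "v \<in> (\<lambda>i. x ^ i) ` {..N}" "u v \<noteq> 0"
      unfolding rat_vs.dependent_finite[OF finite_imageI[OF finite_atMost]] by blast
    define p :: "rat poly" where "p = (\<Sum>i\<le>N. Polynomial.monom (u (x ^ i)) i)"
    have c: "poly.coeff p i = (if i \<le> N then u (x ^ i) else 0)" for i
      by (simp add: p_def coeff_sum)
    from u(2) obtain i where "i \<le> N" "v = x ^ i" by auto
    with c[of i] u(3) have "p \<noteq> 0" by auto
    moreover have "map_poly of_rat p = (\<Sum>i\<le>N. Polynomial.monom (of_rat (u (x ^ i)) :: complex) i)"
      by (rule poly_eqI) (simp add: coeff_map_poly c coeff_sum)
    then have "poly (map_poly of_rat p) x = (\<Sum>i\<le>N. of_rat (u (x ^ i)) * x ^ i)"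
      by (simp add: poly_sum poly_monom)
    then have "poly (map_poly of_rat p) x = 0"
      using u(1) True by (simp add: sum.reindex)
    ultimately show ?thesis by blast
  qed
qed

text \<open>
  The new module is generated by the \<open>v * a ^ i\<close> with \<open>v\<close> a generator of the old one and \<open>i\<close> below the
  degree of a monic integer equation of \<open>a\<close>; that equation rewrites all higher powers of \<open>a\<close>.
\<close>
lemma span_adjoin_algebraic_int:
  assumes V: "finite V" and a: "algebraic_int a"
  obtains W where "finite W" "int_mod.span V \<subseteq> int_mod.span W"
    "\<And>m. m \<in> int_mod.span W \<Longrightarrow> a * m \<in> int_mod.span W"
    "\<And>s m. \<forall>m\<in>int_mod.span V. s * m \<in> int_mod.span V \<Longrightarrow>
       m \<in> int_mod.span W \<Longrightarrow> s * m \<in> int_mod.span W"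
proof -
  obtain p :: "int poly" where p: "poly (map_poly of_int p) a = 0" "lead_coeff p = 1"
    using a by (auto simp: algebraic_int_altdef_ipoly)
  define n where "n = Polynomial.degree p"
  have deg: "Polynomial.degree (map_poly of_int p :: complex poly) = n"
    by (simp add: n_def degree_map_poly)
  have "n > 0"
    using p unfolding poly_altdef deg by (cases n) (auto simp: coeff_map_poly n_def)
  define W where "W = (\<lambda>(v, i). v * a ^ i) ` (V \<times> {..<n})"
  have "0 = poly (map_poly of_int p) a" using p by simp
  also have "\<dots> = (\<Sum>i\<le>n. of_int (poly.coeff p i) * a ^ i)"
    unfolding poly_altdef deg by (simp add: coeff_map_poly)
  also have "{..n} = insert n {..<n}" by auto
  also have "(\<Sum>i\<in>\<dots>. of_int (poly.coeff p i) * a ^ i) = a ^ n + (\<Sum>i<n. of_int (poly.coeff p i) * a ^ i)"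
    using p(2) by (simp add: n_def)
  finally have an: "a ^ n = - (\<Sum>i<n. of_int (poly.coeff p i) * a ^ i)"
    by (simp add: eq_neg_iff_add_eq_0)
  have small: "m * a ^ i \<in> int_mod.span W" if "m \<in> int_mod.span V" "i < n" for m i
    using that(1)
  proof (induction rule: int_mod.span_induct_alt)
    case base
    then show ?case using int_mod.span_zero by simp
  next
    case (step c v y)
    have "v * a ^ i \<in> W" using step that(2) by (force simp: W_def)
    then have "of_int c * (v * a ^ i) + y * a ^ i \<in> int_mod.span W"
      using step by (intro int_mod.span_add int_mod.span_scale) (auto intro: int_mod.span_base)
    then show ?case by (simp add: algebra_simps)
  qed
  have all: "m * a ^ i \<in> int_mod.span W" if "m \<in> int_mod.span V" for m i
  proof (induction i rule: less_induct)
    case (less i)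
    show ?case
    proof (cases "i < n")
      case True
      then show ?thesis using small that by blast
    next
      case False
      then have "m * a ^ i = m * a ^ (i - n) * a ^ n" by (simp flip: power_add)
      also have "\<dots> = - (\<Sum>j<n. of_int (poly.coeff p j) * (m * a ^ (i - n + j)))"
        by (simp add: an sum_distrib_left power_add mult_ac)
      also have "\<dots> \<in> int_mod.span W"
        using False \<open>n > 0\<close>
        by (intro int_mod.span_neg int_mod.span_sum int_mod.span_scale less) auto
      finally show ?thesis .
    qed
  qed
  show thesis
  proof (rule that[of W])
    show "finite W" using V by (simp add: W_def)
    show "int_mod.span V \<subseteq> int_mod.span W" using all[of _ 0] by auto
    show "a * m \<in> int_mod.span W" if "m \<in> int_mod.span W" for m
      using that
    proof (induction rule: int_mod.span_induct_alt)
      case base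
      then show ?case using int_mod.span_zero by simp
    next
      case (step c w y)
      from step(1) obtain v i where w: "w = v * a ^ i" "v \<in> V" by (auto simp: W_def)
      have "v * a ^ Suc i \<in> int_mod.span W" using all w int_mod.span_base by blast
      then have "of_int c * (v * a ^ Suc i) + a * y \<in> int_mod.span W"
        using step by (intro int_mod.span_add int_mod.span_scale)
      then show ?case by (simp add: w algebra_simps)
    qed
    show "s * m \<in> int_mod.span W"
      if s: "\<forall>m\<in>int_mod.span V. s * m \<in> int_mod.span V" and "m \<in> int_mod.span W" for s m
      using that(2)
    proof (induction rule: int_mod.span_induct_alt)
      case base
      then show ?case using int_mod.span_zero by simp
    next
      case (step c w y)
      from step(1) obtain v i where w: "w = v * a ^ i" "v \<in> V" by (auto simp: W_def)
      have "s * v * a ^ i \<in> int_mod.span W" using s all w int_mod.span_base by blast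
      then have "of_int c * (s * v * a ^ i) + s * y \<in> int_mod.span W"
        using step by (intro int_mod.span_add int_mod.span_scale)
      then show ?case by (simp add: w algebra_simps)
    qed
  qed
qed

text \<open>
  This replaces the ring of all algebraic integers. Only the stated consequences of integrality are
  used, and for the ring generated by finitely many algebraic integers they follow from a single
  finitely generated module that is stable under the ring.
\<close>
definition integral_ring :: "complex set \<Rightarrow> bool" where
  "integral_ring R \<longleftrightarrow> 1 \<in> R \<and> (\<forall>x\<in>R. \<forall>y\<in>R. x + y \<in> R \<and> x - y \<in> R \<and> x * y \<in> R) \<and>
     R \<inter> \<rat> \<subseteq> \<int> \<and> (\<forall>x\<in>R. \<exists>p::rat poly. p \<noteq> 0 \<and> poly (map_poly of_rat p) x = 0)"

lemma integral_ring_exists: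
  assumes "finite S" "\<And>s. s \<in> S \<Longrightarrow> algebraic_int s"
  obtains R where "S \<subseteq> R" "integral_ring R"
proof -
  have "\<exists>V. finite V \<and> 1 \<in> int_mod.span V \<and>
          (\<forall>s\<in>S. \<forall>m\<in>int_mod.span V. s * m \<in> int_mod.span V)"
    using assms
  proof (induction S rule: finite_induct)
    case empty
    then show ?case by (intro exI[of _ "{1}"]) (auto intro: int_mod.span_base)
  next
    case (insert a S)
    then obtain V where V: "finite V" "1 \<in> int_mod.span V"
      "\<forall>s\<in>S. \<forall>m\<in>int_mod.span V. s * m \<in> int_mod.span V" by auto
    obtain W where W: "finite W" "int_mod.span V \<subseteq> int_mod.span W"
      "\<And>m. m \<in> int_mod.span W \<Longrightarrow> a * m \<in> int_mod.span W"
      "\<And>s m. \<forall>m\<in>int_mod.span V. s * m \<in> int_mod.span V \<Longrightarrow>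
         m \<in> int_mod.span W \<Longrightarrow> s * m \<in> int_mod.span W"
      using span_adjoin_algebraic_int[OF V(1) insert.prems[OF insertI1]] by blast
    show ?case using W V by (intro exI[of _ W]) blast
  qed
  then obtain V where V: "finite V" "1 \<in> int_mod.span V"
    "\<And>s m. s \<in> S \<Longrightarrow> m \<in> int_mod.span V \<Longrightarrow> s * m \<in> int_mod.span V" by blast
  show thesis
  proof (rule that[of "{x. \<forall>m\<in>int_mod.span V. x * m \<in> int_mod.span V}"])
    show "integral_ring {x. \<forall>m\<in>int_mod.span V. x * m \<in> int_mod.span V}"
      unfolding integral_ring_def
      using rational_multiplier_in_Ints[OF V(1,2)] multiplier_algebraic[OF V(1,2)]
      by (auto simp: ring_distribs mult.assoc intro: int_mod.span_add int_mod.span_diff)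
  qed (use V in blast)
qed

section \<open>Mahler measure and coefficients\<close>

definition sq_norm :: "complex poly \<Rightarrow> real" where
  "sq_norm p = (\<Sum>i\<le>Polynomial.degree p. (cmod (poly.coeff p i))\<^sup>2)"

lemma sq_norm_eq: "Polynomial.degree p \<le> N \<Longrightarrow> sq_norm p = (\<Sum>i\<le>N. (cmod (poly.coeff p i))\<^sup>2)"
  unfolding sq_norm_def by (rule sum.mono_neutral_left) (auto intro: coeff_eq_0)

lemma lead_coeff_le_sq_norm: "(cmod (lead_coeff p))\<^sup>2 \<le> sq_norm p"
  unfolding sq_norm_def by (rule member_le_sum) auto

lemma cmod_sq_reflect:
  "(cmod (u - a * v))\<^sup>2 = (cmod (v - cnj a * u))\<^sup>2 + (1 - (cmod a)\<^sup>2) * ((cmod u)\<^sup>2 - (cmod v)\<^sup>2)"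
  unfolding cmod_power2 by (simp add: algebra_simps power2_eq_square)

text \<open>
  Reflecting a root in the unit circle keeps the Euclidean norm: on the unit circle the factors
  \<open>z - a\<close> and \<open>1 - cnj a * z\<close> have equal absolute value. In terms of coefficients, the error term of
  \<open>cmod_sq_reflect\<close> sums to zero, because multiplication by the variable only shifts coefficients.
\<close>
lemma sq_norm_reflect: "sq_norm ([:-a, 1:] * p) = sq_norm ([:1, -cnj a:] * p)"
proof -
  define N where "N = Suc (Polynomial.degree p)"
  let ?c = "poly.coeff p" and ?s = "poly.coeff (pCons 0 p)"
  have "Polynomial.degree ([:-a, 1:] * p) \<le> N" "Polynomial.degree ([:1, -cnj a:] * p) \<le> N"
    unfolding N_def by (rule degree_mult_le[THEN order_trans]; simp)+
  note norms = this[THEN sq_norm_eq]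
  have shift: "(\<Sum>i\<le>N. (cmod (?s i))\<^sup>2) = (\<Sum>i\<le>N. (cmod (?c i))\<^sup>2)"
    unfolding N_def by (subst sum.atMost_Suc_shift) (simp add: coeff_eq_0)
  have "sq_norm ([:-a, 1:] * p) = (\<Sum>i\<le>N. (cmod (?s i - a * ?c i))\<^sup>2)"
    unfolding norms by (simp add: algebra_simps)
  also have "\<dots> = (\<Sum>i\<le>N. (cmod (?c i - cnj a * ?s i))\<^sup>2) +
      (1 - (cmod a)\<^sup>2) * (\<Sum>i\<le>N. (cmod (?s i))\<^sup>2 - (cmod (?c i))\<^sup>2)"
    unfolding sum_distrib_left sum.distrib[symmetric] by (intro sum.cong refl cmod_sq_reflect)
  also have "\<dots> = (\<Sum>i\<le>N. (cmod (?c i - cnj a * ?s i))\<^sup>2)"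
    by (simp add: sum_subtractf shift)
  also have "\<dots> = sq_norm ([:1, -cnj a:] * p)"
    unfolding norms
    by (intro sum.cong refl arg_cong[where f = "\<lambda>x. (cmod x)\<^sup>2"])
       (simp add: coeff_pCons split: nat.splits)
  finally show ?thesis .
qed

text \<open>
  Reflect all roots outside the unit circle. The norm does not change, and the leading coefficient
  becomes, in absolute value, the product of the absolute values of these roots.
\<close>
lemma landau_inequality:
  assumes "finite A"
  shows "(\<Prod>i\<in>A. max 1 (cmod (z i)))\<^sup>2 \<le> sq_norm (\<Prod>i\<in>A. [:-z i, 1:])"
proof -
  define G where "G i = (if cmod (z i) > 1 then [:1, -cnj (z i):] else [:-z i, 1:])" for i
  have "sq_norm ((\<Prod>i\<in>A. [:-z i, 1:]) * q) = sq_norm ((\<Prod>i\<in>A. G i) * q)" for q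
    using assms
  proof (induction A arbitrary: q rule: finite_induct)
    case (insert i A)
    have "sq_norm ((\<Prod>i\<in>insert i A. [:-z i, 1:]) * q) =
        sq_norm ((\<Prod>i\<in>A. [:-z i, 1:]) * ([:-z i, 1:] * q))"
      unfolding prod.insert[OF insert.hyps] by (simp only: mult_ac)
    also have "\<dots> = sq_norm ([:-z i, 1:] * ((\<Prod>i\<in>A. G i) * q))"
      unfolding insert.IH by (simp only: mult_ac)
    also have "\<dots> = sq_norm (G i * ((\<Prod>i\<in>A. G i) * q))"
      by (cases "cmod (z i) > 1") (simp_all only: G_def[of i] sq_norm_reflect if_True if_False)
    also have "\<dots> = sq_norm ((\<Prod>i\<in>insert i A. G i) * q)"
      unfolding prod.insert[OF insert.hyps] by (simp only: mult_ac)
    finally show ?case .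
  qed simp
  from this[of 1] have "sq_norm (\<Prod>i\<in>A. [:-z i, 1:]) = sq_norm (\<Prod>i\<in>A. G i)" by simp
  moreover have "cmod (lead_coeff (G i)) = max 1 (cmod (z i))" for i
    by (auto simp: G_def)
  then have "cmod (lead_coeff (\<Prod>i\<in>A. G i)) = (\<Prod>i\<in>A. max 1 (cmod (z i)))"
    by (simp add: lead_coeff_prod prod_norm[symmetric])
  ultimately show ?thesis using lead_coeff_le_sq_norm[of "\<Prod>i\<in>A. G i"] by simp
qed

lemma norm_coeff_prod_linear_le:
  assumes "finite A"
  shows "cmod (poly.coeff (\<Prod>i\<in>A. [:-z i, 1:]) k) \<le> (\<Prod>i\<in>A. 1 + cmod (z i))"
  using assms
proof (induction A arbitrary: k rule: finite_induct)
  case empty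
  then show ?case by (simp add: coeff_1)
next
  case (insert i A)
  define q M where "q = (\<Prod>i\<in>A. [:-z i, 1:])" and "M = (\<Prod>i\<in>A. 1 + cmod (z i))"
  have IH: "cmod (poly.coeff q k) \<le> M" for k using insert.IH by (simp add: q_def M_def)
  have "M \<ge> 0" by (auto simp: M_def intro!: prod_nonneg)
  have "cmod (poly.coeff (pCons 0 q) k) \<le> M"
    using IH \<open>M \<ge> 0\<close> by (auto simp: coeff_pCons split: nat.splits)
  moreover have "cmod (z i * poly.coeff q k) \<le> cmod (z i) * M"
    using IH by (simp add: norm_mult mult_left_mono)
  ultimately have "cmod (poly.coeff (pCons 0 q) k - z i * poly.coeff q k) \<le> M + cmod (z i) * M"
    using norm_triangle_ineq4[of "poly.coeff (pCons 0 q) k" "z i * poly.coeff q k"] by linarith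
  moreover have "poly.coeff ([:-z i, 1:] * q) k = poly.coeff (pCons 0 q) k - z i * poly.coeff q k"
    by simp
  ultimately have "cmod (poly.coeff ([:-z i, 1:] * q) k) \<le> M + cmod (z i) * M"
    by (simp only:)
  then show ?case
    unfolding prod.insert[OF insert.hyps] q_def[symmetric] M_def[symmetric]
    by (simp only: distrib_right mult_1_left)
qed

section \<open>Integer vectors with bounded product of entries\<close>

lemma sum_reciprocals_le:
  "(\<Sum>k=1..N. 1 / real k) \<le> 1 + ln (max 1 (real N))"
proof (induction N)
  case (Suc N)
  show ?case
  proof (cases "N = 0")
    case False
    then have N: "real N > 0" by simp
    have "ln (real N / real (Suc N)) \<le> real N / real (Suc N) - 1"
      using N by (intro ln_le_minus_one) auto
    then have "1 / real (Suc N) \<le> ln (real (Suc N)) - ln (real N)"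
      using N by (simp add: ln_div field_simps)
    then show ?thesis using Suc False by (simp add: max_def)
  qed simp
qed simp

lemma sum_reciprocals_int_le:
  assumes "Y \<ge> 1"
  shows "(\<Sum>k \<in> {- \<lfloor>Y\<rfloor> .. \<lfloor>Y\<rfloor>}. 1 / real_of_int (max 1 \<bar>k\<bar>)) \<le> 3 + 2 * ln Y"
proof -
  define N where "N = nat \<lfloor>Y\<rfloor>"
  have N: "\<lfloor>Y\<rfloor> = int N" "N \<ge> 1" using assms by (auto simp: N_def le_nat_iff)
  let ?g = "\<lambda>k::int. 1 / real_of_int (max 1 \<bar>k\<bar>)"
  have split: "{-int N..int N} = insert 0 (int ` {1..N} \<union> (\<lambda>k. - int k) ` {1..N})"
  proof (intro equalityI subsetI)
    fix k assume k: "k \<in> {-int N..int N}"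
    consider "k = 0" | "k > 0" | "k < 0" by linarith
    then show "k \<in> insert 0 (int ` {1..N} \<union> (\<lambda>k. - int k) ` {1..N})"
    proof cases
      case 2
      then have "k = int (nat k)" "nat k \<in> {1..N}" using k by auto
      then show ?thesis by blast
    next
      case 3
      then have "k = - int (nat (-k))" "nat (-k) \<in> {1..N}" using k by auto
      then show ?thesis by blast
    qed simp
  qed auto
  have "(\<Sum>k\<in>{-int N..int N}. ?g k) =
      ?g 0 + ((\<Sum>k\<in>int ` {1..N}. ?g k) + (\<Sum>k\<in>(\<lambda>k. - int k) ` {1..N}. ?g k))"
    unfolding split by (subst sum.insert; (subst sum.union_disjoint)?) auto
  also have "\<dots> = 1 + 2 * (\<Sum>k=1..N. 1 / real k)"
    by (simp add: sum.reindex inj_on_def max_def)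
  also have "\<dots> \<le> 3 + 2 * ln (max 1 (real N))"
    using sum_reciprocals_le[of N] by simp
  also have "ln (max 1 (real N)) \<le> ln Y"
    using N assms by (subst ln_le_cancel_iff) (auto simp: le_floor_iff[symmetric] max_def, linarith?)
  finally show ?thesis using N by simp
qed

text \<open>
  Rankin's trick: every vector \<open>v\<close> of the set is counted with the weight
  \<open>Y / (\<Prod>i. max 1 \<bar>v i\<bar>) \<ge> 1\<close>, and the sum of the weights over a whole box factors into sums of
  reciprocals.
\<close>
lemma card_int_vectors_le:
  fixes I :: "'i set"
  assumes I: "finite I" and Y: "Y \<ge> 1"
  defines "V \<equiv> {v \<in> I \<rightarrow>\<^sub>E (UNIV :: int set). (\<Prod>i\<in>I. real_of_int (max 1 \<bar>v i\<bar>)) \<le> Y}"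
  shows "finite V" and "real (card V) \<le> Y * (3 + 2 * ln Y) ^ card I"
proof -
  let ?B = "{- \<lfloor>Y\<rfloor> .. \<lfloor>Y\<rfloor>}"
  let ?m = "\<lambda>k::int. real_of_int (max 1 \<bar>k\<bar>)"
  have "V \<subseteq> I \<rightarrow>\<^sub>E ?B"
  proof
    fix v assume v: "v \<in> V"
    have "v i \<in> ?B" if "i \<in> I" for i
    proof -
      have "real_of_int \<bar>v i\<bar> \<le> ?m (v i) * 1" by simp
      also have "\<dots> \<le> ?m (v i) * (\<Prod>i\<in>I - {i}. ?m (v i))"
        by (intro mult_left_mono prod_ge_1) simp_all
      also have "\<dots> = (\<Prod>i\<in>I. ?m (v i))"
        using prod.remove[OF I that, of "\<lambda>i. ?m (v i)"] by (rule sym)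
      also have "\<dots> \<le> Y" using v by (simp add: V_def)
      finally have "\<bar>v i\<bar> \<le> \<lfloor>Y\<rfloor>" by (simp add: le_floor_iff)
      then show ?thesis by (simp add: abs_le_iff)
    qed
    then show "v \<in> I \<rightarrow>\<^sub>E ?B" using v by (auto simp: V_def PiE_def)
  qed
  moreover have fin: "finite (I \<rightarrow>\<^sub>E ?B)" using I by (intro finite_PiE) auto
  ultimately show "finite V" using finite_subset by blast
  have "real (card V) = (\<Sum>v\<in>V. 1)" by simp
  also have "\<dots> \<le> (\<Sum>v\<in>V. Y * (\<Prod>i\<in>I. 1 / ?m (v i)))"
  proof (rule sum_mono)
    fix v assume "v \<in> V"
    then have "(\<Prod>i\<in>I. ?m (v i)) \<le> Y" by (simp add: V_def)
    moreover have "(\<Prod>i\<in>I. ?m (v i)) > 0" by (intro prod_pos) simp_all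
    ultimately show "1 \<le> Y * (\<Prod>i\<in>I. 1 / ?m (v i))"
      by (simp only: prod_dividef prod.neutral_const times_divide_eq_right mult_1_right le_divide_eq_1_pos)
  qed
  also have "\<dots> \<le> (\<Sum>v\<in>I \<rightarrow>\<^sub>E ?B. Y * (\<Prod>i\<in>I. 1 / ?m (v i)))"
    using fin \<open>V \<subseteq> _\<close> Y by (intro sum_mono2 mult_nonneg_nonneg prod_nonneg) simp_all
  also have "\<dots> = Y * (\<Prod>i\<in>I. \<Sum>k\<in>?B. 1 / ?m k)"
    unfolding sum_distrib_left[symmetric]
    using I by (intro arg_cong[where f = "\<lambda>x. Y * x"] prod_sum_PiE[symmetric]) simp_all
  also have "(\<Prod>i\<in>I. \<Sum>k\<in>?B. 1 / ?m k) = (\<Sum>k\<in>?B. 1 / ?m k) ^ card I"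
    by (rule prod_constant)
  also have "Y * (\<Sum>k\<in>?B. 1 / ?m k) ^ card I \<le> Y * (3 + 2 * ln Y) ^ card I"
    using sum_reciprocals_int_le[OF Y] Y
    by (intro mult_left_mono power_mono sum_nonneg) simp_all
  finally show "real (card V) \<le> Y * (3 + 2 * ln Y) ^ card I" .
qed

lemma ln_power_le_powr:
  fixes \<epsilon> :: real
  assumes "\<epsilon> > 0"
  shows "\<exists>C>0. \<forall>Y\<ge>1. Y * (3 + 2 * ln Y) ^ n \<le> C * Y powr (1 + \<epsilon>)"
proof -
  \<comment> \<open>The \<open>n\<close> logarithmic factors share the exponent
    \<open>\<epsilon>\<close>; \<open>n + 1\<close> avoids division by zero.\<close>
  define \<delta> where "\<delta> = \<epsilon> / (n + 1)"
  have \<delta>: "\<delta> > 0" "\<delta> * n \<le> \<epsilon>" using assms by (auto simp: \<delta>_def field_simps)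
  show ?thesis
  proof (intro exI[of _ "(3 + 2 / \<delta>) ^ n"] conjI allI impI)
    show "(3 + 2 / \<delta>) ^ n > 0" using \<delta> by (intro zero_less_power) (simp add: add_pos_pos)
    fix Y :: real assume Y: "Y \<ge> 1"
    have "1 \<le> Y powr \<delta>" using Y \<delta> by (simp add: ge_one_powr_ge_zero)
    moreover have "ln Y \<le> Y powr \<delta> / \<delta>" using ln_powr_bound Y \<delta> by blast
    ultimately have "3 + 2 * ln Y \<le> (3 + 2 / \<delta>) * Y powr \<delta>"
      by (simp add: field_simps)
    then have "(3 + 2 * ln Y) ^ n \<le> ((3 + 2 / \<delta>) * Y powr \<delta>) ^ n"
      using Y by (intro power_mono) auto
    also have "\<dots> = (3 + 2 / \<delta>) ^ n * Y powr (\<delta> * n)"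
      using Y by (simp add: power_mult_distrib powr_powr flip: powr_realpow)
    also have "\<dots> \<le> (3 + 2 / \<delta>) ^ n * Y powr \<epsilon>"
      using Y \<delta> by (intro mult_left_mono powr_mono) auto
    finally have "Y * (3 + 2 * ln Y) ^ n \<le> Y * ((3 + 2 / \<delta>) ^ n * Y powr \<epsilon>)"
      using Y by (intro mult_left_mono) auto
    then show "Y * (3 + 2 * ln Y) ^ n \<le> (3 + 2 / \<delta>) ^ n * Y powr (1 + \<epsilon>)"
      using Y by (simp add: powr_add mult_ac)
  qed
qed

section \<open>Subfields of the complex numbers\<close>

text \<open>
  The field \<open>\<rat>(S)\<close>. Splitting fields have this form, and all subfields below are taken of this form,
  so that one induction rule (\<open>rat_adjoin_induct\<close>) covers them.
\<close>
definition rat_adjoin :: "complex set \<Rightarrow> complex set" where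
  "rat_adjoin S = generate_field complex_field (\<rat> \<union> S)"

lemma complex_field_simps [simp]:
  "carrier (ring_of_type_algebra :: complex ring) = UNIV"
  "\<one>\<^bsub>ring_of_type_algebra\<^esub> = (1::complex)" "\<zero>\<^bsub>ring_of_type_algebra\<^esub> = (0::complex)"
  "x \<oplus>\<^bsub>ring_of_type_algebra\<^esub> y = x + (y::complex)" "x \<otimes>\<^bsub>ring_of_type_algebra\<^esub> y = x * (y::complex)"
  by (simp_all add: ring_of_type_algebra_def)

interpretation complex_field: cring complex_field
  by (rule cring_from_type_algebra)

lemma complex_field_uminus [simp]: "\<ominus>\<^bsub>complex_field\<^esub> x = - x"
  using complex_field.minus_equality[of "-x" x] by simp

lemma complex_field_inverse: "x \<noteq> 0 \<Longrightarrow> inv\<^bsub>complex_field\<^esub> x = inverse x"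
  using complex_field.comm_inv_char[of x "inverse x"] by simp

lemma rat_adjoin_rat: "x \<in> \<rat> \<Longrightarrow> x \<in> rat_adjoin S"
  unfolding rat_adjoin_def by (rule generate_field.incl) simp

lemma rat_adjoin_incl: "x \<in> S \<Longrightarrow> x \<in> rat_adjoin S"
  unfolding rat_adjoin_def by (rule generate_field.incl) simp

lemma rat_adjoin_uminus: "x \<in> rat_adjoin S \<Longrightarrow> - x \<in> rat_adjoin S"
  unfolding rat_adjoin_def using generate_field.a_inv[of x complex_field] by simp

lemma rat_adjoin_add: "x \<in> rat_adjoin S \<Longrightarrow> y \<in> rat_adjoin S \<Longrightarrow> x + y \<in> rat_adjoin S"
  unfolding rat_adjoin_def using generate_field.eng_add[of x complex_field _ y] by simp

lemma rat_adjoin_mult: "x \<in> rat_adjoin S \<Longrightarrow> y \<in> rat_adjoin S \<Longrightarrow> x * y \<in> rat_adjoin S"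
  unfolding rat_adjoin_def using generate_field.eng_mult[of x complex_field _ y] by simp

lemma rat_adjoin_diff: "x \<in> rat_adjoin S \<Longrightarrow> y \<in> rat_adjoin S \<Longrightarrow> x - y \<in> rat_adjoin S"
  using rat_adjoin_add[OF _ rat_adjoin_uminus] by fastforce

lemma rat_adjoin_inverse: "x \<in> rat_adjoin S \<Longrightarrow> inverse x \<in> rat_adjoin S"
  unfolding rat_adjoin_def using generate_field.m_inv[of x complex_field] complex_field_inverse[of x]
  by (cases "x = 0") auto

lemma rat_adjoin_divide: "x \<in> rat_adjoin S \<Longrightarrow> y \<in> rat_adjoin S \<Longrightarrow> x / y \<in> rat_adjoin S"
  unfolding divide_inverse by (intro rat_adjoin_mult rat_adjoin_inverse)

lemma rat_adjoin_sum: "(\<And>i. i \<in> I \<Longrightarrow> f i \<in> rat_adjoin S) \<Longrightarrow> sum f I \<in> rat_adjoin S"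
  by (induction I rule: infinite_finite_induct) (auto intro: rat_adjoin_add rat_adjoin_rat)

lemma rat_adjoin_prod: "(\<And>i. i \<in> I \<Longrightarrow> f i \<in> rat_adjoin S) \<Longrightarrow> prod f I \<in> rat_adjoin S"
  by (induction I rule: infinite_finite_induct) (auto intro: rat_adjoin_mult rat_adjoin_rat)

lemmas rat_adjoin_intros =
  rat_adjoin_uminus rat_adjoin_add rat_adjoin_mult rat_adjoin_diff
  rat_adjoin_inverse rat_adjoin_divide rat_adjoin_sum rat_adjoin_prod

lemma rat_adjoin_induct [consumes 1, case_names rat incl uminus inverse add mult]:
  assumes "x \<in> rat_adjoin S"
    and "\<And>x. x \<in> \<rat> \<Longrightarrow> P x" "\<And>x. x \<in> S \<Longrightarrow> P x"
    and "\<And>x. x \<in> rat_adjoin S \<Longrightarrow> P x \<Longrightarrow> P (- x)"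
    and "\<And>x. x \<in> rat_adjoin S \<Longrightarrow> P x \<Longrightarrow> x \<noteq> 0 \<Longrightarrow> P (inverse x)"
    and "\<And>x y. x \<in> rat_adjoin S \<Longrightarrow> y \<in> rat_adjoin S \<Longrightarrow> P x \<Longrightarrow> P y \<Longrightarrow> P (x + y)"
    and "\<And>x y. x \<in> rat_adjoin S \<Longrightarrow> y \<in> rat_adjoin S \<Longrightarrow> P x \<Longrightarrow> P y \<Longrightarrow> P (x * y)"
  shows "P x"
  using assms(1) unfolding rat_adjoin_def
proof (induction rule: generate_field.induct)
  case (m_inv h)
  then show ?case using assms(5)[of h] by (simp add: complex_field_inverse rat_adjoin_def)
qed (use assms(2-4,6-7) in \<open>auto simp: rat_adjoin_def\<close>)

lemma rat_adjoin_least: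
  assumes "S \<subseteq> rat_adjoin T"
  shows "rat_adjoin S \<subseteq> rat_adjoin T"
proof
  fix x assume "x \<in> rat_adjoin S"
  then show "x \<in> rat_adjoin T"
    by (induction rule: rat_adjoin_induct)
       (use assms in \<open>auto intro: rat_adjoin_rat rat_adjoin_intros\<close>)
qed

lemma rat_adjoin_empty: "rat_adjoin {} = \<rat>"
proof (intro equalityI subsetI)
  fix x assume "x \<in> rat_adjoin {}"
  then show "x \<in> \<rat>"
    by (induction rule: rat_adjoin_induct) auto
qed (rule rat_adjoin_rat)

text \<open>
  Polynomials over the field \<open>\<rat>(S)\<close>; \<open>S = {}\<close> gives the rational polynomials.
\<close>
definition poly_over :: "complex set \<Rightarrow> complex poly \<Rightarrow> bool" where
  "poly_over S p \<longleftrightarrow> (\<forall>i. poly.coeff p i \<in> rat_adjoin S)"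

lemma poly_over_pCons [simp]: "poly_over S (pCons a p) \<longleftrightarrow> a \<in> rat_adjoin S \<and> poly_over S p"
  unfolding poly_over_def by (auto simp: coeff_pCons split: nat.splits)

lemma poly_over_0 [simp]: "poly_over S 0"
  by (simp add: poly_over_def rat_adjoin_rat)

lemma poly_over_add: "poly_over S p \<Longrightarrow> poly_over S q \<Longrightarrow> poly_over S (p + q)"
  by (simp add: poly_over_def rat_adjoin_add)

lemma poly_over_diff: "poly_over S p \<Longrightarrow> poly_over S q \<Longrightarrow> poly_over S (p - q)"
  by (simp add: poly_over_def rat_adjoin_diff)

lemma poly_over_mult: "poly_over S p \<Longrightarrow> poly_over S q \<Longrightarrow> poly_over S (p * q)"
  by (simp add: poly_over_def coeff_mult rat_adjoin_sum rat_adjoin_mult)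

lemma poly_over_monom: "c \<in> rat_adjoin S \<Longrightarrow> poly_over S (Polynomial.monom c k)"
  by (simp add: poly_over_def rat_adjoin_rat)

lemma poly_over_pcompose: "poly_over S p \<Longrightarrow> poly_over S q \<Longrightarrow> poly_over S (p \<circ>\<^sub>p q)"
  by (induction p) (auto simp: pcompose_pCons intro!: poly_over_add poly_over_mult)

lemma poly_over_pderiv: "poly_over S p \<Longrightarrow> poly_over S (pderiv p)"
  by (simp add: poly_over_def coeff_pderiv rat_adjoin_mult rat_adjoin_rat)

lemma poly_over_of_int: "poly_over S (map_poly of_int f)"
  by (simp add: poly_over_def coeff_map_poly rat_adjoin_rat)

lemma poly_in_rat_adjoin: "poly_over S p \<Longrightarrow> x \<in> rat_adjoin S \<Longrightarrow> poly p x \<in> rat_adjoin S"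
  by (induction p) (auto intro: rat_adjoin_intros rat_adjoin_rat)

lemma poly_over_mono: "poly_over {} p \<Longrightarrow> poly_over S p"
  by (simp add: poly_over_def rat_adjoin_empty rat_adjoin_rat)

lemma poly_over_division:
  assumes "poly_over S p" "poly_over S d" "d \<noteq> 0"
  shows "\<exists>q r. poly_over S q \<and> poly_over S r \<and> p = q * d + r \<and>
    (r = 0 \<or> Polynomial.degree r < Polynomial.degree d)"
  using assms(1)
proof (induction "Polynomial.degree p" arbitrary: p rule: less_induct)
  case less
  show ?case
  proof (cases "p = 0 \<or> Polynomial.degree p < Polynomial.degree d")
    case True
    then show ?thesis using less.prems by (intro exI[of _ 0] exI[of _ p]) auto
  next
    case False
    define m where "m = Polynomial.monom (lead_coeff p / lead_coeff d) (Polynomial.degree p - Polynomial.degree d)"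
    have m: "poly_over S m"
      unfolding m_def using less.prems assms(2)
      by (intro poly_over_monom rat_adjoin_divide) (simp_all add: poly_over_def)
    define p' where "p' = p - m * d"
    have p': "poly_over S p'"
      unfolding p'_def using less.prems assms(2) m by (intro poly_over_diff poly_over_mult)
    have "lead_coeff p \<noteq> 0" "lead_coeff d \<noteq> 0" using False assms(3) by auto
    then have degm: "Polynomial.degree m = Polynomial.degree p - Polynomial.degree d" "m \<noteq> 0"
      by (auto simp: m_def degree_monom_eq)
    have deg_md: "Polynomial.degree (m * d) = Polynomial.degree p"
      using degm assms(3) False by (simp add: degree_mult_eq)
    have "lead_coeff (m * d) = lead_coeff p"
      using \<open>lead_coeff d \<noteq> 0\<close> degm(1) by (simp add: lead_coeff_mult m_def)
    then have "poly.coeff p' (Polynomial.degree p) = 0"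
      by (simp add: p'_def deg_md)
    moreover have "Polynomial.degree p' \<le> Polynomial.degree p"
      unfolding p'_def by (rule degree_diff_le) (simp_all add: deg_md)
    ultimately have "p' = 0 \<or> Polynomial.degree p' < Polynomial.degree p"
      by (metis leading_coeff_0_iff le_neq_implies_less)
    then show ?thesis
    proof
      assume "p' = 0"
      then have "p = m * d + 0" by (simp add: p'_def)
      then show ?thesis using m by (intro exI[of _ m] exI[of _ 0]) simp
    next
      assume "Polynomial.degree p' < Polynomial.degree p"
      from less.hyps[OF this p'] obtain q r where
        "poly_over S q" "poly_over S r" "p' = q * d + r" "r = 0 \<or> Polynomial.degree r < Polynomial.degree d"
        by blast
      moreover from this have "p = (q + m) * d + r" by (simp add: p'_def algebra_simps)
      ultimately show ?thesis using m poly_over_add by blast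
    qed
  qed
qed

definition minimal_poly :: "complex set \<Rightarrow> complex \<Rightarrow> complex poly \<Rightarrow> bool" where
  "minimal_poly S a d \<longleftrightarrow> poly_over S d \<and> d \<noteq> 0 \<and> poly d a = 0 \<and>
     (\<forall>p. poly_over S p \<and> p \<noteq> 0 \<and> poly p a = 0 \<longrightarrow> Polynomial.degree d \<le> Polynomial.degree p)"

lemma minimal_poly_exists:
  assumes "poly_over S p" "p \<noteq> 0" "poly p a = 0"
  obtains d where "minimal_poly S a d"
  using ex_has_least_nat[of "\<lambda>p. poly_over S p \<and> p \<noteq> 0 \<and> poly p a = 0" p Polynomial.degree] assms
  unfolding minimal_poly_def by blast

lemma minimal_poly_dvd:
  assumes d: "minimal_poly S a d" and p: "poly_over S p" "poly p a = 0"
  shows "d dvd p"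
proof -
  obtain q r where qr: "poly_over S r" "p = q * d + r" "r = 0 \<or> Polynomial.degree r < Polynomial.degree d"
    using poly_over_division[OF p(1), of d] d unfolding minimal_poly_def by blast
  have "poly r a = 0" using qr(2) p(2) d by (simp add: minimal_poly_def)
  then have "r = 0" using d qr by (auto simp: minimal_poly_def)
  then show ?thesis using qr(2) by simp
qed

lemma rsquarefree_dvd:
  fixes d :: "'a :: field_char_0 poly"
  assumes "rsquarefree p" "d dvd p"
  shows "rsquarefree d"
proof -
  obtain e where "p = d * e" using assms(2) by blast
  show ?thesis
    using assms(1) unfolding \<open>p = d * e\<close> rsquarefree_roots by (auto simp: pderiv_mult)
qed

text \<open>
  With \<open>\<theta> = a + c * b\<close>, the number \<open>b\<close> is a common root of \<open>F\<close> and of \<open>P(\<theta> - c * x)\<close>. For all but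
  finitely many \<open>c\<close> it is the only one. The minimal polynomial of \<open>b\<close> over \<open>\<rat>(\<theta>)\<close> divides both and
  has simple roots, hence is linear.
\<close>
lemma primitive_element_step:
  assumes P: "poly_over {} P" "P \<noteq> 0" "poly P a = 0"
    and F: "poly_over {} F" "rsquarefree F" "poly F b = 0"
  shows "\<exists>c::nat. {a, b} \<subseteq> rat_adjoin {a + of_nat c * b}"
proof -
  have "F \<noteq> 0" using F(2) by (simp add: rsquarefree_def)
  \<comment> \<open>If \<open>b' \<noteq> b\<close> were another common root, then \<open>a' =
    \<theta> - c * b'\<close> would be a root of \<open>P\<close>, and solving
    for \<open>c\<close> gives a value of this form.\<close>
  define bad where "bad = (\<lambda>(a', b'). (a' - a) / (b - b')) ` ({x. poly P x = 0} \<times> {x. poly F x = 0})"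
  have "finite bad"
    unfolding bad_def using P(2) \<open>F \<noteq> 0\<close> by (intro finite_imageI finite_cartesian_product poly_roots_finite)
  then have "finite ((of_nat :: nat \<Rightarrow> complex) -` bad)"
    by (rule finite_vimageI) (simp add: inj_on_def)
  then obtain c :: nat where c: "of_nat c \<notin> bad"
    using ex_new_if_finite[OF infinite_UNIV_nat] by blast
  define \<theta> where "\<theta> = a + of_nat c * b"
  let ?K = "rat_adjoin {\<theta>}"
  have \<theta>: "\<theta> \<in> ?K" by (rule rat_adjoin_incl) simp
  define Q where "Q = P \<circ>\<^sub>p [:\<theta>, - of_nat c:]"
  have Q: "poly_over {\<theta>} Q" "poly Q b = 0"
    unfolding Q_def using P(1,3) \<theta>
    by (simp_all add: poly_over_pcompose poly_over_mono rat_adjoin_uminus rat_adjoin_rat poly_pcompose,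
        simp add: \<theta>_def)
  obtain d where d: "minimal_poly {\<theta>} b d"
    using minimal_poly_exists[of "{\<theta>}" F b] F \<open>F \<noteq> 0\<close> poly_over_mono by blast
  have dF: "d dvd F" using minimal_poly_dvd[OF d] F poly_over_mono by blast
  have dQ: "d dvd Q" using minimal_poly_dvd[OF d] Q by blast
  have "b' = b" if "poly d b' = 0" for b'
  proof (rule ccontr)
    assume "b' \<noteq> b"
    have "poly F b' = 0" using dF that by auto
    moreover have "poly Q b' = 0" using dQ that by auto
    then have "poly P (\<theta> - of_nat c * b') = 0"
      by (simp add: Q_def poly_pcompose mult.commute)
    moreover have "of_nat c = ((\<theta> - of_nat c * b') - a) / (b - b')"
      using \<open>b' \<noteq> b\<close> by (simp add: \<theta>_def field_simps)
    ultimately have "of_nat c \<in> bad"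
      unfolding bad_def by (intro image_eqI[of _ _ "(\<theta> - of_nat c * b', b')"]) simp_all
    then show False using c by blast
  qed
  then have "{z. poly d z = 0} = {b}" using d by (auto simp: minimal_poly_def)
  then have "d = Polynomial.smult (lead_coeff d) [:-b, 1:]"
    using complex_poly_decompose_rsquarefree[OF rsquarefree_dvd[OF F(2) dF]] by simp
  then have "poly.coeff d 0 = poly.coeff (Polynomial.smult (lead_coeff d) [:-b, 1:]) 0"
    by (rule arg_cong)
  moreover have "lead_coeff d \<noteq> 0" using d by (simp add: minimal_poly_def)
  ultimately have "b = - poly.coeff d 0 / lead_coeff d" by simp
  also have "\<dots> \<in> ?K" using d by (intro rat_adjoin_intros) (simp_all add: minimal_poly_def poly_over_def)
  finally have b: "b \<in> ?K" .
  have "a = \<theta> - of_nat c * b" by (simp add: \<theta>_def)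
  also have "\<dots> \<in> ?K" using b \<theta> by (intro rat_adjoin_diff rat_adjoin_mult) (auto intro: rat_adjoin_rat)
  finally have "{a, b} \<subseteq> ?K" using b by simp
  then show ?thesis unfolding \<theta>_def by (rule exI)
qed

text \<open>
  Membership of \<open>\<theta>\<close> in \<open>R\<close> is carried along since it makes every intermediate generator algebraic,
  as the next step requires.
\<close>
lemma primitive_element:
  assumes R: "integral_ring R" and F: "poly_over {} F" "rsquarefree F"
    and S: "finite S" "S \<subseteq> R" "S \<subseteq> {x. poly F x = 0}"
  shows "\<exists>\<theta>\<in>R. \<theta> \<in> rat_adjoin S \<and> S \<subseteq> rat_adjoin {\<theta>}"
  using S
proof (induction S rule: finite_induct)
  case empty
  then show ?case using R by (intro bexI[of _ 1]) (auto simp: integral_ring_def rat_adjoin_rat)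
next
  case (insert b S)
  then obtain a where a: "a \<in> R" "a \<in> rat_adjoin S" "S \<subseteq> rat_adjoin {a}" by auto
  obtain p :: "rat poly" where p: "p \<noteq> 0" "poly (map_poly of_rat p) a = 0"
    using R a(1) by (auto simp: integral_ring_def)
  have "poly_over {} (map_poly of_rat p)"
    by (simp add: poly_over_def coeff_map_poly rat_adjoin_rat)
  moreover have "map_poly of_rat p \<noteq> (0 :: complex poly)"
    using p(1) by (simp add: map_poly_eq_0_iff)
  ultimately obtain c :: nat where c: "{a, b} \<subseteq> rat_adjoin {a + of_nat c * b}"
    using primitive_element_step[of "map_poly of_rat p" a F b] p F insert.prems by auto
  let ?\<theta> = "a + of_nat c * b"
  have nat: "of_nat c \<in> R"
  proof (induction c)
    case 0
    have "1 - 1 \<in> R" using R unfolding integral_ring_def by blast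
    then show ?case by simp
  next
    case (Suc c)
    then have "1 + of_nat c \<in> R" using R unfolding integral_ring_def by blast
    then show ?case by simp
  qed
  show ?case
  proof (intro bexI[of _ ?\<theta>] conjI)
    have "of_nat c * b \<in> R" using nat insert.prems R unfolding integral_ring_def by blast
    then show "?\<theta> \<in> R" using a(1) R unfolding integral_ring_def by blast
    have "rat_adjoin S \<subseteq> rat_adjoin (insert b S)"
      by (rule rat_adjoin_least) (auto intro: rat_adjoin_incl)
    then show "?\<theta> \<in> rat_adjoin (insert b S)"
      using a(2) by (intro rat_adjoin_add rat_adjoin_mult) (auto intro: rat_adjoin_rat rat_adjoin_incl)
    have "rat_adjoin {a} \<subseteq> rat_adjoin {?\<theta>}" using c by (intro rat_adjoin_least) auto
    then show "insert b S \<subseteq> rat_adjoin {?\<theta>}" using a(3) c by auto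
  qed
qed

section \<open>Automorphisms of splitting fields\<close>

text \<open>
  A field homomorphism on \<open>L\<close> into the complex numbers. Fixing \<open>\<rat>\<close> pointwise is part of the
  definition, so that \<open>s 1 = 1\<close> comes for free.
\<close>
definition rat_hom_on :: "complex set \<Rightarrow> (complex \<Rightarrow> complex) \<Rightarrow> bool" where
  "rat_hom_on L s \<longleftrightarrow> (\<forall>x\<in>\<rat>. s x = x) \<and>
     (\<forall>x\<in>L. \<forall>y\<in>L. s (x + y) = s x + s y \<and> s (x * y) = s x * s y)"

definition field_auts :: "complex set \<Rightarrow> (complex \<Rightarrow> complex) set" where
  "field_auts L = carrier (Gal (complex_field\<lparr>carrier := L\<rparr>) \<rat>)"

lemma field_auts_iff:
  assumes "\<rat> \<subseteq> L"
  shows "\<sigma> \<in> field_auts L \<longleftrightarrow> \<sigma> \<in> extensional L \<and> bij_betw \<sigma> L L \<and> rat_hom_on L \<sigma>"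
proof -
  have "1 \<in> L" using assms Rats_1 by blast
  then show ?thesis
    unfolding field_auts_def Gal_def rat_hom_on_def
    by (auto simp: ring_iso_def ring_hom_def Bij_def ring_of_type_algebra_def bij_betw_def)
qed

lemma rats_subset_rat_adjoin: "\<rat> \<subseteq> rat_adjoin S"
  using rat_adjoin_rat by blast

lemma field_autsD:
  assumes "\<sigma> \<in> field_auts (rat_adjoin S)"
  shows "\<sigma> \<in> extensional (rat_adjoin S)" "bij_betw \<sigma> (rat_adjoin S) (rat_adjoin S)"
    "rat_hom_on (rat_adjoin S) \<sigma>"
  using assms field_auts_iff[OF rats_subset_rat_adjoin] by auto

lemma rat_hom_on_simps:
  assumes "rat_hom_on (rat_adjoin S) s"
  shows "x \<in> \<rat> \<Longrightarrow> s x = x"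
    and "x \<in> rat_adjoin S \<Longrightarrow> y \<in> rat_adjoin S \<Longrightarrow> s (x + y) = s x + s y"
    and "x \<in> rat_adjoin S \<Longrightarrow> y \<in> rat_adjoin S \<Longrightarrow> s (x * y) = s x * s y"
    and "x \<in> rat_adjoin S \<Longrightarrow> s (- x) = - s x"
    and "x \<in> rat_adjoin S \<Longrightarrow> y \<in> rat_adjoin S \<Longrightarrow> s (x - y) = s x - s y"
    and "x \<in> rat_adjoin S \<Longrightarrow> s (inverse x) = inverse (s x)"
    and "(\<And>i. i \<in> I \<Longrightarrow> f i \<in> rat_adjoin S) \<Longrightarrow> s (\<Sum>i\<in>I. f i) = (\<Sum>i\<in>I. s (f i))"
    and "(\<And>i. i \<in> I \<Longrightarrow> f i \<in> rat_adjoin S) \<Longrightarrow> s (\<Prod>i\<in>I. f i) = (\<Prod>i\<in>I. s (f i))"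
proof -
  show rat: "s x = x" if "x \<in> \<rat>" for x
    using assms that by (simp add: rat_hom_on_def)
  show add: "s (x + y) = s x + s y" if "x \<in> rat_adjoin S" "y \<in> rat_adjoin S" for x y
    using assms that by (simp add: rat_hom_on_def)
  show mult: "s (x * y) = s x * s y" if "x \<in> rat_adjoin S" "y \<in> rat_adjoin S" for x y
    using assms that by (simp add: rat_hom_on_def)
  show uminus: "s (- x) = - s x" if "x \<in> rat_adjoin S" for x
    using mult[of "-1" x] rat[of "-1"] that rat_adjoin_rat[of "-1" S] by simp
  show "s (x - y) = s x - s y" if "x \<in> rat_adjoin S" "y \<in> rat_adjoin S" for x y
    using add[of x "- y"] uminus[of y] that rat_adjoin_uminus by simp
  show "s (inverse x) = inverse (s x)" if "x \<in> rat_adjoin S" for x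
  proof (cases "x = 0")
    case False
    then have "s x * s (inverse x) = 1"
      using mult[of x "inverse x"] that rat_adjoin_inverse rat[of 1] by simp
    then show ?thesis by (metis inverse_unique)
  qed (simp add: rat)
  show "s (\<Sum>i\<in>I. f i) = (\<Sum>i\<in>I. s (f i))" if "\<And>i. i \<in> I \<Longrightarrow> f i \<in> rat_adjoin S"
    using that
    by (induction I rule: infinite_finite_induct) (simp_all add: rat add rat_adjoin_sum)
  show "s (\<Prod>i\<in>I. f i) = (\<Prod>i\<in>I. s (f i))" if "\<And>i. i \<in> I \<Longrightarrow> f i \<in> rat_adjoin S"
    using that
    by (induction I rule: infinite_finite_induct) (simp_all add: rat mult rat_adjoin_prod)
qed

lemma rat_hom_on_inj:
  assumes "rat_hom_on (rat_adjoin S) s"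
  shows "inj_on s (rat_adjoin S)"
proof (rule inj_onI)
  note hom = rat_hom_on_simps[OF assms]
  fix x y assume xy: "x \<in> rat_adjoin S" "y \<in> rat_adjoin S" "s x = s y"
  show "x = y"
  proof (rule ccontr)
    assume "x \<noteq> y"
    then have "s ((x - y) * inverse (x - y)) = 1" using hom(1)[of 1] by simp
    moreover have "s ((x - y) * inverse (x - y)) = s (x - y) * s (inverse (x - y))"
      by (rule hom(3)[OF rat_adjoin_diff[OF xy(1,2)] rat_adjoin_inverse[OF rat_adjoin_diff[OF xy(1,2)]]])
    moreover have "s (x - y) = 0" using hom(5)[OF xy(1,2)] xy(3) by simp
    ultimately show False by simp
  qed
qed

lemma rat_hom_on_poly:
  assumes s: "rat_hom_on (rat_adjoin S) s" and "poly_over {} p" and x: "x \<in> rat_adjoin S"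
  shows "s (poly p x) = poly p (s x)"
  using assms(2)
proof (induction p)
  case (pCons a p)
  have "a \<in> \<rat>" "poly_over {} p" using pCons.prems by (simp_all add: rat_adjoin_empty)
  moreover have "poly p x \<in> rat_adjoin S"
    by (rule poly_in_rat_adjoin[OF poly_over_mono[OF \<open>poly_over {} p\<close>] x])
  ultimately show ?case
    using pCons.IH x by (simp add: rat_hom_on_simps(1-3)[OF s] rat_adjoin_mult rat_adjoin_rat)
qed (simp add: rat_hom_on_simps(1)[OF s])

text \<open>
  The image of \<open>\<rat>(S)\<close> is generated by the image of \<open>S\<close>.
\<close>
lemma restrict_in_field_auts:
  assumes s: "rat_hom_on (rat_adjoin S) s" and S: "s ` S = S"
  shows "restrict s (rat_adjoin S) \<in> field_auts (rat_adjoin S)"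
proof -
  let ?L = "rat_adjoin S"
  note hom = rat_hom_on_simps[OF s]
  have into: "s x \<in> ?L" if "x \<in> ?L" for x
    using that
    by (induction rule: rat_adjoin_induct)
       (use S in \<open>auto simp: hom intro: rat_adjoin_rat rat_adjoin_incl rat_adjoin_intros\<close>)
  have "x \<in> s ` ?L" if "x \<in> ?L" for x
    using that
  proof (induction rule: rat_adjoin_induct)
    case (rat x)
    then have "x = s x" "x \<in> ?L" by (simp_all add: hom(1) rat_adjoin_rat)
    then show ?case by (rule image_eqI)
  next
    case (incl x)
    then show ?case using S rat_adjoin_incl by blast
  next
    case (uminus x)
    then obtain y where "y \<in> ?L" "x = s y" by blast
    then show ?case by (intro image_eqI[of _ _ "- y"]) (simp_all add: hom(4) rat_adjoin_uminus)
  next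
    case (inverse x)
    then obtain y where "y \<in> ?L" "x = s y" by blast
    then show ?case by (intro image_eqI[of _ _ "inverse y"]) (simp_all add: hom(6) rat_adjoin_inverse)
  next
    case (add x y)
    then obtain x' y' where "x' \<in> ?L" "x = s x'" "y' \<in> ?L" "y = s y'" by blast
    then show ?case by (intro image_eqI[of _ _ "x' + y'"]) (simp_all add: hom(2) rat_adjoin_add)
  next
    case (mult x y)
    then obtain x' y' where "x' \<in> ?L" "x = s x'" "y' \<in> ?L" "y = s y'" by blast
    then show ?case by (intro image_eqI[of _ _ "x' * y'"]) (simp_all add: hom(3) rat_adjoin_mult)
  qed
  then have "s ` ?L = ?L" using into by blast
  then have "bij_betw (restrict s ?L) ?L ?L"
    using rat_hom_on_inj[OF s] by (simp add: bij_betw_def inj_on_def image_def)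
  moreover have "rat_hom_on ?L (restrict s ?L)"
    unfolding rat_hom_on_def using rat_adjoin_add rat_adjoin_mult rat_adjoin_rat
    by (simp add: hom)
  ultimately show ?thesis
    by (simp add: field_auts_iff[OF rats_subset_rat_adjoin])
qed

text \<open>
  A nonzero combination of \<open>q\<close> and \<open>p\<close> of least degree divides both. It does not vanish at \<open>\<theta>\<close>, as
  \<open>q\<close> does not, so its cofactor in \<open>p\<close> does; the cofactor has full degree by minimality and the
  combination is a constant.
\<close>
lemma minimal_poly_invertible:
  assumes p: "minimal_poly S \<theta> p" and q: "poly_over S q" "poly q \<theta> \<noteq> 0"
  shows "\<exists>v. poly_over S v \<and> poly v \<theta> * poly q \<theta> = 1"
proof -
  define comb where "comb d \<longleftrightarrow> d \<noteq> 0 \<and>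
    (\<exists>u v. poly_over S u \<and> poly_over S v \<and> d = u * q + v * p)" for d
  have "q \<noteq> 0" using q(2) by auto
  have "comb q" unfolding comb_def
  proof (intro conjI exI)
    show "q = 1 * q + 0 * p" by simp
  qed (use \<open>q \<noteq> 0\<close> in \<open>simp_all add: one_pCons rat_adjoin_rat\<close>)
  then obtain d where d: "comb d" "\<And>d'. comb d' \<Longrightarrow> Polynomial.degree d \<le> Polynomial.degree d'"
    using ex_has_least_nat[of comb q Polynomial.degree] by blast
  then obtain u v where uv: "poly_over S u" "poly_over S v" "d = u * q + v * p"
    unfolding comb_def by blast
  have d_over: "poly_over S d"
    using uv p q by (simp add: poly_over_add poly_over_mult minimal_poly_def)
  have "d \<noteq> 0" using d(1) by (simp add: comb_def)
  have "\<exists>e. poly_over S e \<and> g = e * d"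
    if g: "g = a * q + b * p" "poly_over S a" "poly_over S b" for g a b
  proof -
    have "poly_over S g"
      using g p q by (simp add: poly_over_add poly_over_mult minimal_poly_def)
    then obtain e r where er: "poly_over S e" "g = e * d + r"
        "r = 0 \<or> Polynomial.degree r < Polynomial.degree d"
      using poly_over_division[OF _ d_over \<open>d \<noteq> 0\<close>] by blast
    have r: "r = (a - e * u) * q + (b - e * v) * p"
      using er(2) g(1) uv(3) by (simp add: algebra_simps)
    have "r = 0"
    proof (rule ccontr)
      assume "r \<noteq> 0"
      then have "comb r"
        unfolding comb_def
        using r poly_over_diff[OF g(2) poly_over_mult[OF er(1) uv(1)]]
          poly_over_diff[OF g(3) poly_over_mult[OF er(1) uv(2)]] by blast
      then show False using d(2) er(3) \<open>r \<noteq> 0\<close> by fastforce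
    qed
    then show ?thesis using er by auto
  qed
  note dvd = this
  obtain e where e: "poly_over S e" "p = e * d"
    using dvd[of p 0 1] by (auto simp: one_pCons rat_adjoin_rat)
  obtain e' where e': "q = e' * d"
    using dvd[of q 1 0] by (auto simp: one_pCons rat_adjoin_rat)
  have d\<theta>: "poly d \<theta> \<noteq> 0" using q(2) e' by auto
  have "p \<noteq> 0" "poly p \<theta> = 0" using p by (simp_all add: minimal_poly_def)
  then have "e \<noteq> 0" "poly e \<theta> = 0" using e(2) d\<theta> by auto
  then have "Polynomial.degree p \<le> Polynomial.degree e" using p e(1) by (simp add: minimal_poly_def)
  then have "Polynomial.degree d = 0"
    using e(2) \<open>e \<noteq> 0\<close> \<open>d \<noteq> 0\<close> by (simp add: degree_mult_eq)
  then obtain c where c: "d = [:c:]" by (rule degree_eq_zeroE)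
  have c0: "c \<noteq> 0" "c \<in> rat_adjoin S" using c d_over \<open>d \<noteq> 0\<close> by auto
  have "poly d \<theta> = poly u \<theta> * poly q \<theta>" using uv(3) \<open>poly p \<theta> = 0\<close> by simp
  then have "poly u \<theta> * poly q \<theta> = c" using c by simp
  then have "poly ([:inverse c:] * u) \<theta> * poly q \<theta> = 1" using c0 by (simp add: mult.assoc)
  moreover have "poly_over S ([:inverse c:] * u)"
    using uv(1) c0 by (intro poly_over_mult) (simp_all add: rat_adjoin_inverse)
  ultimately show ?thesis by blast
qed

text \<open>
  Irreducibility of minimal polynomials in the form in which it is used: a relation over \<open>\<rat>(S)\<close>
  satisfied by one root is satisfied by all.
\<close>
lemma minimal_poly_conjugate:
  assumes p: "minimal_poly S \<theta> p" and q: "poly_over S q" and z: "poly p z = 0" "poly q z = 0"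
  shows "poly q \<theta> = 0"
proof (rule ccontr)
  assume "poly q \<theta> \<noteq> 0"
  then obtain v where v: "poly_over S v" "poly v \<theta> * poly q \<theta> = 1"
    using minimal_poly_invertible[OF p q] by blast
  have "poly (v * q - 1) \<theta> = 0" using v by simp
  moreover have "poly_over S (v * q - 1)"
    using v q by (intro poly_over_diff poly_over_mult) (simp_all add: one_pCons rat_adjoin_rat)
  ultimately have "p dvd v * q - 1" using minimal_poly_dvd[OF p] by blast
  then have "poly (v * q - 1) z = 0" using z(1) by (metis dvd_def mult_zero_left poly_mult)
  then show False using z(2) by simp
qed

lemma minimal_poly_rsquarefree:
  assumes p: "minimal_poly S \<theta> p"
  shows "rsquarefree p"
proof (rule ccontr)
  assume "\<not> rsquarefree p"
  then obtain z where z: "poly p z = 0" "poly (pderiv p) z = 0"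
    unfolding rsquarefree_roots by blast
  have over: "poly_over S (pderiv p)" using p by (simp add: poly_over_pderiv minimal_poly_def)
  then have "poly (pderiv p) \<theta> = 0" using minimal_poly_conjugate[OF p _ z] by blast
  then have "p dvd pderiv p" using minimal_poly_dvd[OF p over] by blast
  then have "Polynomial.degree p = 0" using not_dvd_pderiv by blast
  then show False using p by (auto simp: minimal_poly_def elim!: degree_eq_zeroE)
qed

lemma card_roots_rsquarefree:
  fixes p :: "complex poly"
  assumes p: "rsquarefree p"
  shows "card {z. poly p z = 0} = Polynomial.degree p"
proof -
  have "p \<noteq> 0" using p by (simp add: rsquarefree_def)
  have "Polynomial.degree p =
      Polynomial.degree (Polynomial.smult (lead_coeff p) (\<Prod>z | poly p z = 0. [:-z, 1:]))"
    using complex_poly_decompose_rsquarefree[OF p] by simp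
  also have "\<dots> = Polynomial.degree (\<Prod>z | poly p z = 0. [:-z, 1:] :: complex poly)"
    using \<open>p \<noteq> 0\<close> by simp
  also have "\<dots> = (\<Sum>z | poly p z = 0. 1)"
    by (subst degree_prod_eq_sum_degree) auto
  finally show ?thesis by simp
qed

lemma rat_adjoin_singleton:
  assumes p: "minimal_poly {} \<theta> p" and x: "x \<in> rat_adjoin {\<theta>}"
  shows "\<exists>q. poly_over {} q \<and> poly q \<theta> = x"
  using x
proof (induction rule: rat_adjoin_induct)
  case (rat x)
  then show ?case by (intro exI[of _ "[:x:]"]) (simp add: rat_adjoin_rat)
next
  case (incl x)
  then show ?case by (intro exI[of _ "[:0, 1:]"]) (simp add: rat_adjoin_rat)
next
  case (uminus x)
  then obtain q where q: "poly_over {} q" "poly q \<theta> = x" by blast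
  then show ?case using poly_over_diff[of "{}" 0 q] by (intro exI[of _ "0 - q"]) simp
next
  case (inverse x)
  then obtain q where q: "poly_over {} q" "poly q \<theta> = x" by blast
  then obtain v where "poly_over {} v" "poly v \<theta> * x = 1"
    using minimal_poly_invertible[OF p q(1)] inverse by blast
  then show ?case by (metis inverse_unique mult.commute)
next
  case (add x y)
  then show ?case using poly_over_add by (metis poly_add)
next
  case (mult x y)
  then show ?case using poly_over_mult by (metis poly_mult)
qed

text \<open>
  Evaluation at \<open>z\<close> of a polynomial expression in \<open>\<theta>\<close> does not depend on the expression, since two
  expressions for the same number differ by a multiple of \<open>p\<close>.
\<close>
lemma conjugation_hom:
  assumes p: "minimal_poly {} \<theta> p" and z: "poly p z = 0"
  obtains s where "rat_hom_on (rat_adjoin {\<theta>}) s"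
    and "\<And>q. poly_over {} q \<Longrightarrow> s (poly q \<theta>) = poly q z"
proof -
  define s where "s x = poly (SOME q. poly_over {} q \<and> poly q \<theta> = x) z" for x
  have s: "s (poly q \<theta>) = poly q z" if q: "poly_over {} q" for q
  proof -
    define q' where "q' = (SOME q'. poly_over {} q' \<and> poly q' \<theta> = poly q \<theta>)"
    have q': "poly_over {} q' \<and> poly q' \<theta> = poly q \<theta>"
      unfolding q'_def by (rule someI[of _ q]) (simp add: q)
    have "p dvd q' - q"
      using minimal_poly_dvd[OF p, of "q' - q"] poly_over_diff q q' by simp
    then have "poly (q' - q) z = 0" using z by (metis dvd_def mult_zero_left poly_mult)
    then show ?thesis by (simp add: s_def q'_def)
  qed
  show thesis
  proof (rule that[of s])
    show "rat_hom_on (rat_adjoin {\<theta>}) s"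
      unfolding rat_hom_on_def
    proof (intro conjI ballI)
      show "s x = x" if "x \<in> \<rat>" for x
        using s[of "[:x:]"] that by (simp add: rat_adjoin_rat)
    next
      fix x y assume "x \<in> rat_adjoin {\<theta>}" "y \<in> rat_adjoin {\<theta>}"
      then obtain q r where "poly_over {} q" "x = poly q \<theta>" "poly_over {} r" "y = poly r \<theta>"
        using rat_adjoin_singleton[OF p] by metis
      then show "s (x + y) = s x + s y" "s (x * y) = s x * s y"
        using s[of "q + r"] s[of "q * r"] poly_over_add[of "{}" q r] poly_over_mult[of "{}" q r]
        by (simp_all add: s)
    qed
  qed (rule s)
qed

lemma complex_roots_finite: "lead_coeff f = 1 \<Longrightarrow> finite (complex_roots f)"
  unfolding complex_roots_def by (rule poly_roots_finite) (auto simp: map_poly_eq_0_iff)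

lemma complex_roots_algebraic_int:
  "lead_coeff f = 1 \<Longrightarrow> \<alpha> \<in> complex_roots f \<Longrightarrow> algebraic_int \<alpha>"
  by (auto simp: algebraic_int_altdef_ipoly complex_roots_def)

text \<open>
  This is what makes a splitting field normal: every homomorphism defined on it is an automorphism.
\<close>
lemma rat_hom_on_permutes_roots:
  assumes f: "lead_coeff f = 1" and s: "rat_hom_on (rat_adjoin (complex_roots f)) s"
  shows "s ` complex_roots f = complex_roots f"
proof -
  have "s \<alpha> \<in> complex_roots f" if "\<alpha> \<in> complex_roots f" for \<alpha>
    using rat_hom_on_poly[OF s poly_over_of_int rat_adjoin_incl[OF that], of f] that
      rat_hom_on_simps(1)[OF s]
    by (simp add: complex_roots_def)
  then have "s ` complex_roots f \<subseteq> complex_roots f" by blast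
  moreover have "inj_on s (complex_roots f)"
    using rat_hom_on_inj[OF s] by (rule inj_on_subset) (blast intro: rat_adjoin_incl)
  ultimately show ?thesis
    using complex_roots_finite[OF f] by (simp add: endo_inj_surj)
qed

text \<open>
  Write \<open>L = \<rat>(\<theta>)\<close> and \<open>x = q(\<theta>)\<close> with \<open>q\<close> of degree below that of the minimal polynomial \<open>p\<close> of
  \<open>\<theta>\<close>. Each root \<open>z\<close> of \<open>p\<close> gives an automorphism moving \<open>\<theta>\<close> to \<open>z\<close>, so \<open>q(z) = x\<close>. Thus \<open>q - x\<close> has
  more roots than its degree permits, and \<open>q\<close> is the constant \<open>x\<close>.
\<close>
theorem fixed_field_rational:
  assumes f: "lead_coeff f = 1" "separable f"
    and x: "x \<in> rat_adjoin (complex_roots f)"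
    and fixed: "\<And>\<sigma>. \<sigma> \<in> field_auts (rat_adjoin (complex_roots f)) \<Longrightarrow> \<sigma> x = x"
  shows "x \<in> \<rat>"
proof -
  let ?S = "complex_roots f" and ?F = "map_poly of_int f :: complex poly"
  obtain R where R: "?S \<subseteq> R" "integral_ring R"
    using integral_ring_exists[of ?S] f complex_roots_finite complex_roots_algebraic_int by metis
  obtain \<theta> where \<theta>: "\<theta> \<in> R" "\<theta> \<in> rat_adjoin ?S" "?S \<subseteq> rat_adjoin {\<theta>}"
    using primitive_element[OF R(2), of ?F ?S] R(1) f complex_roots_finite
    by (auto simp: poly_over_of_int separable_def complex_roots_def)
  have L: "rat_adjoin ?S = rat_adjoin {\<theta>}"
    using \<theta> rat_adjoin_least[of ?S "{\<theta>}"] rat_adjoin_least[of "{\<theta>}" ?S] by blast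
  \<comment> \<open>As an element of \<open>R\<close>, \<open>\<theta>\<close> is algebraic, so
    it has a minimal polynomial.\<close>
  obtain h :: "rat poly" where h: "h \<noteq> 0" "poly (map_poly of_rat h) \<theta> = 0"
    using R(2) \<theta>(1) by (auto simp: integral_ring_def)
  obtain p where p: "minimal_poly {} \<theta> p"
    using minimal_poly_exists[of "{}" "map_poly of_rat h" \<theta>] h
    by (auto simp: poly_over_def coeff_map_poly rat_adjoin_rat map_poly_eq_0_iff)
  have deg: "Polynomial.degree p > 0"
    using p by (intro Nat.gr0I) (auto simp: minimal_poly_def elim!: degree_eq_zeroE)
  obtain q where q: "poly_over {} q" "poly q \<theta> = x" "Polynomial.degree q < Polynomial.degree p"
  proof -
    obtain q where q: "poly_over {} q" "poly q \<theta> = x"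
      using rat_adjoin_singleton[OF p] x L by blast
    have p': "poly_over {} p" "p \<noteq> 0" "poly p \<theta> = 0" using p by (simp_all add: minimal_poly_def)
    from poly_over_division[OF q(1) p'(1,2)] obtain e r where
      "poly_over {} r" "q = e * p + r" "r = 0 \<or> Polynomial.degree r < Polynomial.degree p" by blast
    then show thesis using that[of r] q p' deg by auto
  qed
  have "poly (q - [:x:]) z = 0" if z: "poly p z = 0" for z
  proof -
    obtain s where s: "rat_hom_on (rat_adjoin {\<theta>}) s"
      "\<And>q. poly_over {} q \<Longrightarrow> s (poly q \<theta>) = poly q z"
      using conjugation_hom[OF p z] by blast
    have hom: "rat_hom_on (rat_adjoin ?S) s" using s(1) by (simp only: L)
    have "restrict s (rat_adjoin ?S) \<in> field_auts (rat_adjoin ?S)"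
      using hom rat_hom_on_permutes_roots[OF f(1) hom] by (rule restrict_in_field_auts)
    from fixed[OF this] have "s x = x" using x by simp
    then show ?thesis using s(2)[OF q(1)] q(2) by simp
  qed
  moreover have "Polynomial.degree (q - [:x:]) < Polynomial.degree p"
    using q(3) deg by (intro degree_diff_less) auto
  ultimately have "q - [:x:] = 0"
    using card_poly_roots_bound[of "q - [:x:]"] card_roots_rsquarefree[OF minimal_poly_rsquarefree[OF p]]
      card_mono[OF poly_roots_finite, of "q - [:x:]" "{z. poly p z = 0}"]
    by fastforce
  then have "q = [:x:]" by simp
  then show "x \<in> \<rat>" using q(1) by (simp add: rat_adjoin_empty)
qed

section \<open>Polynomials with regular Galois group\<close>

text \<open>
  Regularity of the Galois group on the roots is expressed by transitivity and the equality of its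
  order with the number of roots, and the group itself by its set of elements; the action is function
  application.
\<close>
locale regular_galois =
  fixes f :: "int poly"
  assumes monic: "lead_coeff f = 1"
    and separable: "separable f"
    and finite_auts: "finite (field_auts (rat_adjoin (complex_roots f)))"
    and card_auts: "card (field_auts (rat_adjoin (complex_roots f))) = Polynomial.degree f"
    and transitive: "\<alpha> \<in> complex_roots f \<Longrightarrow> \<beta> \<in> complex_roots f \<Longrightarrow>
      \<exists>\<sigma>\<in>field_auts (rat_adjoin (complex_roots f)). \<sigma> \<alpha> = \<beta>"
begin

abbreviation "S \<equiv> complex_roots f"
abbreviation "L \<equiv> rat_adjoin S"
abbreviation "\<Gamma> \<equiv> field_auts L"

lemma finite_roots: "finite S"
  using complex_roots_finite monic by blast

lemma roots_subset: "S \<subseteq> L"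
  using rat_adjoin_incl by blast

lemma hom: "\<sigma> \<in> \<Gamma> \<Longrightarrow> rat_hom_on L \<sigma>"
  using field_autsD(3) by blast

lemma aut_in: "\<sigma> \<in> \<Gamma> \<Longrightarrow> x \<in> L \<Longrightarrow> \<sigma> x \<in> L"
  using field_autsD(2) bij_betwE by blast

lemma aut_inj: "\<sigma> \<in> \<Gamma> \<Longrightarrow> x \<in> L \<Longrightarrow> y \<in> L \<Longrightarrow> \<sigma> x = \<sigma> y \<longleftrightarrow> x = y"
  using field_autsD(2)[of \<sigma> S] by (auto simp: bij_betw_def inj_on_def)

lemma aut_root: "\<sigma> \<in> \<Gamma> \<Longrightarrow> \<alpha> \<in> S \<Longrightarrow> \<sigma> \<alpha> \<in> S"
  using rat_hom_on_permutes_roots[OF monic hom] by blast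

lemma aut_eqI:
  assumes "\<sigma> \<in> \<Gamma>" "\<tau> \<in> \<Gamma>" "\<And>x. x \<in> L \<Longrightarrow> \<sigma> x = \<tau> x"
  shows "\<sigma> = \<tau>"
  using assms field_autsD(1) by (intro extensionalityI[of _ L]) auto

lemma aut_of_hom: "rat_hom_on L s \<Longrightarrow> restrict s L \<in> \<Gamma>"
  using restrict_in_field_auts rat_hom_on_permutes_roots[OF monic] by blast

lemma id_aut: "restrict id L \<in> \<Gamma>"
  by (rule aut_of_hom) (simp add: rat_hom_on_def)

lemma aut_compose:
  assumes "\<sigma> \<in> \<Gamma>" "\<tau> \<in> \<Gamma>"
  shows "compose L \<sigma> \<tau> \<in> \<Gamma>"
proof -
  have "rat_hom_on L (\<lambda>x. \<sigma> (\<tau> x))"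
    unfolding rat_hom_on_def
    using assms by (simp add: rat_hom_on_simps(1-3)[OF hom] aut_in)
  then show ?thesis using aut_of_hom by (simp add: compose_def)
qed

lemma aut_cnj: "\<sigma> \<in> \<Gamma> \<Longrightarrow> (\<lambda>x\<in>L. cnj (\<sigma> x)) \<in> \<Gamma>"
  using hom[of \<sigma>] by (intro aut_of_hom) (auto simp: rat_hom_on_def elim!: Rats_cases')

lemma bij_betw_compose:
  assumes "\<sigma> \<in> \<Gamma>"
  shows "bij_betw (compose L \<sigma>) \<Gamma> \<Gamma>"
proof -
  have "inj_on (compose L \<sigma>) \<Gamma>"
  proof (rule inj_onI)
    fix \<tau> \<rho> assume *: "\<tau> \<in> \<Gamma>" "\<rho> \<in> \<Gamma>" "compose L \<sigma> \<tau> = compose L \<sigma> \<rho>"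
    show "\<tau> = \<rho>"
    proof (rule aut_eqI[OF *(1,2)])
      fix x assume x: "x \<in> L"
      then have "\<sigma> (\<tau> x) = \<sigma> (\<rho> x)" using *(3) by (metis compose_eq)
      then show "\<tau> x = \<rho> x" using aut_inj[OF assms] aut_in * x by blast
    qed
  qed
  moreover have "compose L \<sigma> ` \<Gamma> \<subseteq> \<Gamma>" using aut_compose assms by blast
  ultimately show ?thesis using finite_auts by (simp add: bij_betw_def endo_inj_surj)
qed

lemma fixed_rational:
  assumes "x \<in> L" "\<And>\<sigma>. \<sigma> \<in> \<Gamma> \<Longrightarrow> \<sigma> x = x"
  shows "x \<in> \<rat>"
  by (rule fixed_field_rational[OF monic separable]) (use assms in auto)

lemma card_roots: "card S = Polynomial.degree f"
proof -
  have "card S = Polynomial.degree (map_poly of_int f :: complex poly)"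
    using separable card_roots_rsquarefree by (simp add: complex_roots_def separable_def)
  then show ?thesis by (simp add: degree_map_poly)
qed

lemma degree_pos: "Polynomial.degree f > 0"
  using card_auts finite_auts id_aut by (metis card_gt_0_iff empty_iff)

lemma roots_nonempty: "S \<noteq> {}"
  using card_roots degree_pos by auto

lemma bij_betw_conjugates:
  assumes "\<alpha> \<in> S"
  shows "bij_betw (\<lambda>\<sigma>. \<sigma> \<alpha>) \<Gamma> S"
proof -
  have "(\<lambda>\<sigma>. \<sigma> \<alpha>) ` \<Gamma> = S"
    using transitive[OF assms] aut_root[OF _ assms] by blast
  moreover from this have "inj_on (\<lambda>\<sigma>. \<sigma> \<alpha>) \<Gamma>"
    using finite_auts card_auts card_roots by (intro eq_card_imp_inj_on) auto
  ultimately show ?thesis by (simp add: bij_betw_def)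
qed

lemma poly_eq_prod_roots: "map_poly of_int f = (\<Prod>z\<in>S. [:-z, 1:])"
proof -
  have "lead_coeff (map_poly of_int f :: complex poly) = 1"
    using monic by (simp add: degree_map_poly coeff_map_poly)
  then show ?thesis
    using complex_poly_decompose_rsquarefree[of "map_poly of_int f"] separable
    by (simp add: separable_def complex_roots_def)
qed

text \<open>
  Landau's inequality bounds the Mahler measure of \<open>f\<close> linearly in its height.
\<close>
lemma prod_max_roots_le:
  assumes "real_of_int (height f) \<le> H" "0 \<le> H"
  shows "(\<Prod>z\<in>S. max 1 (cmod z)) \<le> sqrt (real (Polynomial.degree f) + 1) * H"
proof -
  let ?n = "Polynomial.degree f"
  have "(\<Prod>z\<in>S. max 1 (cmod z))\<^sup>2 \<le> sq_norm (map_poly of_int f)"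
    unfolding poly_eq_prod_roots by (rule landau_inequality[OF finite_roots])
  also have "\<dots> = (\<Sum>i\<le>?n. (real_of_int \<bar>poly.coeff f i\<bar>)\<^sup>2)"
    by (simp add: sq_norm_def degree_map_poly coeff_map_poly)
  also have "\<dots> \<le> (\<Sum>i\<le>?n. H\<^sup>2)"
  proof (rule sum_mono)
    fix i assume "i \<in> {..?n}"
    then have "\<bar>poly.coeff f i\<bar> \<le> height f"
      unfolding height_def by (intro Max_ge) auto
    then have "real_of_int \<bar>poly.coeff f i\<bar> \<le> H" using assms(1) by linarith
    then show "(real_of_int \<bar>poly.coeff f i\<bar>)\<^sup>2 \<le> H\<^sup>2" by (intro power_mono) auto
  qed
  also have "\<dots> = (sqrt (real ?n + 1) * H)\<^sup>2"
    by (simp add: power_mult_distrib algebra_simps)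
  finally show ?thesis by (rule power2_le_imp_le) (use assms(2) in simp)
qed

lemma aut_coeff_prod_linear:
  assumes \<sigma>: "\<sigma> \<in> \<Gamma>" and I: "finite I" "\<And>i. i \<in> I \<Longrightarrow> z i \<in> L"
  shows "poly_over S (\<Prod>i\<in>I. [:-z i, 1:])"
    and "\<sigma> (poly.coeff (\<Prod>i\<in>I. [:-z i, 1:]) k) = poly.coeff (\<Prod>i\<in>I. [:-\<sigma> (z i), 1:]) k"
  using I
proof (induction I arbitrary: k rule: finite_induct)
  case empty
  {
    case 1
    show ?case by (simp add: one_pCons rat_adjoin_rat)
  next
    case 2
    show ?case by (simp add: coeff_1 rat_hom_on_simps(1)[OF hom[OF \<sigma>]])
  }
next
  case (insert i I)
  note h = rat_hom_on_simps[OF hom[OF \<sigma>]]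
  let ?p = "\<Prod>i\<in>I. [:-z i, 1:]" and ?q = "\<Prod>i\<in>I. [:-\<sigma> (z i), 1:]"
  {
    case 1
    then show ?case
      unfolding prod.insert[OF insert.hyps] using insert.IH(1)
      by (intro poly_over_mult) (simp_all add: rat_adjoin_uminus rat_adjoin_rat)
  next
    case 2
    have IH: "\<sigma> (poly.coeff ?p k) = poly.coeff ?q k" for k
      using insert.IH(2) 2 by simp
    have L: "poly.coeff ?p k \<in> L" "z i \<in> L" for k
      using insert.IH(1) 2 by (simp_all add: poly_over_def)
    have c: "poly.coeff ([:-a, 1:] * p) k = poly.coeff (pCons 0 p) k - a * poly.coeff p k"
      for a :: complex and p by simp
    have "\<sigma> (poly.coeff (pCons 0 ?p) k - z i * poly.coeff ?p k) =
        poly.coeff (pCons 0 ?q) k - \<sigma> (z i) * poly.coeff ?q k"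
      using L by (cases k) (simp_all add: h(1,3,4,5) rat_adjoin_mult IH)
    then show ?case
      unfolding prod.insert[OF insert.hyps] c .
  }
qed

text \<open>
  The norm of \<open>x\<close> is fixed by \<open>\<Gamma>\<close>, hence rational, hence an integer.
\<close>
lemma norm_lt_1_imp_zero:
  assumes R: "integral_ring R" and x: "x \<in> L" "\<And>\<sigma>. \<sigma> \<in> \<Gamma> \<Longrightarrow> \<sigma> x \<in> R"
    and small: "\<And>\<sigma>. \<sigma> \<in> \<Gamma> \<Longrightarrow> cmod (\<sigma> x) < 1"
  shows "x = 0"
proof -
  define N where "N = (\<Prod>\<sigma>\<in>\<Gamma>. \<sigma> x)"
  have "N \<in> L" unfolding N_def using x(1) aut_in by (intro rat_adjoin_prod) blast
  moreover have "\<tau> N = N" if \<tau>: "\<tau> \<in> \<Gamma>" for \<tau>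
  proof -
    have "\<tau> N = (\<Prod>\<sigma>\<in>\<Gamma>. \<tau> (\<sigma> x))"
      unfolding N_def using x(1) aut_in by (intro rat_hom_on_simps(8)[OF hom[OF \<tau>]]) blast
    also have "\<dots> = (\<Prod>\<sigma>\<in>\<Gamma>. compose L \<tau> \<sigma> x)" using x(1) by (simp add: compose_eq)
    also have "\<dots> = N"
      unfolding N_def using prod.reindex_bij_betw[OF bij_betw_compose[OF \<tau>], of "\<lambda>\<sigma>. \<sigma> x"] .
    finally show ?thesis .
  qed
  ultimately have "N \<in> \<rat>" using fixed_rational by blast
  moreover have "(\<Prod>\<sigma>\<in>A. \<sigma> x) \<in> R" if "A \<subseteq> \<Gamma>" for A
    using that x(2) R
    by (induction A rule: infinite_finite_induct) (auto simp: integral_ring_def)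
  then have "N \<in> R" unfolding N_def by blast
  ultimately have "N \<in> \<int>" using R by (auto simp: integral_ring_def)
  then obtain m where m: "N = of_int m" by (auto simp: Ints_def)
  have "cmod N < 1"
  proof -
    obtain \<sigma> where \<sigma>: "\<sigma> \<in> \<Gamma>" using id_aut by blast
    have "cmod N = cmod (\<sigma> x) * (\<Prod>\<sigma>\<in>\<Gamma> - {\<sigma>}. cmod (\<sigma> x))"
      unfolding N_def prod_norm[symmetric] using prod.remove[OF finite_auts \<sigma>] .
    also have "\<dots> \<le> cmod (\<sigma> x) * 1"
      using small by (intro mult_left_mono prod_le_1) (auto intro: less_imp_le)
    also have "\<dots> < 1" using small[OF \<sigma>] by simp
    finally show ?thesis .
  qed
  then have "N = 0" using m by simp
  then obtain \<sigma> where "\<sigma> \<in> \<Gamma>" "\<sigma> x = 0" unfolding N_def using finite_auts by auto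
  then show ?thesis
    using aut_inj[of \<sigma> x 0] x(1) rat_hom_on_simps(1)[OF hom, of \<sigma> 0] rat_adjoin_rat[of 0] by simp
qed

text \<open>
  As for primitive elements, each new \<open>b\<close> is added with a factor \<open>c\<close> that avoids the finitely many
  values for which two automorphisms could agree on the sum without agreeing on both summands.
\<close>
lemma separating_element:
  assumes "finite T" "T \<subseteq> L"
  shows "\<exists>\<theta>\<in>rat_adjoin T \<inter> L. \<forall>\<sigma>\<in>\<Gamma>. \<forall>\<tau>\<in>\<Gamma>. \<sigma> \<theta> = \<tau> \<theta> \<longrightarrow> (\<forall>t\<in>T. \<sigma> t = \<tau> t)"
  using assms
proof (induction T rule: finite_induct)
  case empty
  then show ?case by (intro bexI[of _ 0]) (simp_all add: rat_adjoin_rat)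
next
  case (insert b T)
  then obtain \<theta> where \<theta>: "\<theta> \<in> rat_adjoin T" "\<theta> \<in> L"
    "\<And>\<sigma> \<tau>. \<sigma> \<in> \<Gamma> \<Longrightarrow> \<tau> \<in> \<Gamma> \<Longrightarrow> \<sigma> \<theta> = \<tau> \<theta> \<Longrightarrow> (\<forall>t\<in>T. \<sigma> t = \<tau> t)" by auto
  define bad where "bad = (\<lambda>(\<sigma>, \<tau>). (\<sigma> \<theta> - \<tau> \<theta>) / (\<tau> b - \<sigma> b)) ` (\<Gamma> \<times> \<Gamma>)"
  have "finite bad" unfolding bad_def using finite_auts by blast
  then have "finite ((of_nat :: nat \<Rightarrow> complex) -` bad)"
    by (rule finite_vimageI) (simp add: inj_on_def)
  then obtain c :: nat where c: "of_nat c \<notin> bad"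
    using ex_new_if_finite[OF infinite_UNIV_nat] by blast
  let ?\<theta> = "\<theta> + of_nat c * b"
  have b: "b \<in> L" "of_nat c \<in> L" "of_nat c * b \<in> L"
    using insert.prems by (simp_all add: rat_adjoin_mult rat_adjoin_rat)
  show ?case
  proof (intro bexI[of _ ?\<theta>] ballI impI)
    have "rat_adjoin T \<subseteq> rat_adjoin (insert b T)"
      by (rule rat_adjoin_least) (auto intro: rat_adjoin_incl)
    then have "\<theta> \<in> rat_adjoin (insert b T)" using \<theta>(1) by blast
    then show "?\<theta> \<in> rat_adjoin (insert b T) \<inter> L"
      using \<theta>(2) b by (simp add: rat_adjoin_add rat_adjoin_mult rat_adjoin_rat rat_adjoin_incl)
  next
    fix \<sigma> \<tau> t assume *: "\<sigma> \<in> \<Gamma>" "\<tau> \<in> \<Gamma>" "\<sigma> ?\<theta> = \<tau> ?\<theta>" "t \<in> insert b T"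
    have eq: "\<sigma> \<theta> + of_nat c * \<sigma> b = \<tau> \<theta> + of_nat c * \<tau> b"
      using * \<theta>(2) b by (simp add: rat_hom_on_simps(1-3)[OF hom])
    have "\<sigma> b = \<tau> b"
    proof (rule ccontr)
      assume "\<sigma> b \<noteq> \<tau> b"
      then have "of_nat c = (\<sigma> \<theta> - \<tau> \<theta>) / (\<tau> b - \<sigma> b)"
        using eq by (simp add: field_simps)
      then have "of_nat c \<in> bad"
        unfolding bad_def using * by (intro image_eqI[of _ _ "(\<sigma>, \<tau>)"]) simp_all
      then show False using c by blast
    qed
    then show "\<sigma> t = \<tau> t" using eq \<theta>(3)[of \<sigma> \<tau>] * by auto
  qed
qed

text \<open>
  Divided by \<open>\<Prod>\<tau>. X - \<tau> \<theta>\<close>, this polynomial is the sum of the fractions \<open>\<sigma> x / (X - \<sigma> \<theta>)\<close>;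
  applying an automorphism only permutes the fractions.
\<close>
lemma interpolation_poly_rational:
  assumes \<theta>: "\<theta> \<in> L" and x: "x \<in> L"
  defines "P \<equiv> (\<Sum>\<sigma>\<in>\<Gamma>. Polynomial.smult (\<sigma> x) (\<Prod>\<tau>\<in>\<Gamma> - {\<sigma>}. [:-\<tau> \<theta>, 1:]))"
  shows "poly_over {} P"
proof -
  have "poly.coeff P k \<in> \<rat>" for k
  proof (rule fixed_rational)
    have P: "poly.coeff P k = (\<Sum>\<sigma>\<in>\<Gamma>. \<sigma> x * poly.coeff (\<Prod>\<tau>\<in>\<Gamma> - {\<sigma>}. [:-\<tau> \<theta>, 1:]) k)"
      by (simp add: P_def coeff_sum)
    have c: "poly.coeff (\<Prod>\<tau>\<in>\<Gamma> - {\<sigma>}. [:-\<tau> \<theta>, 1:]) k \<in> L" for \<sigma>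
      using aut_coeff_prod_linear(1)[OF id_aut, of "\<Gamma> - {\<sigma>}" "\<lambda>\<tau>. \<tau> \<theta>"] finite_auts aut_in \<theta>
      by (simp add: poly_over_def)
    show "poly.coeff P k \<in> L"
      unfolding P using c x aut_in by (intro rat_adjoin_sum rat_adjoin_mult) auto
    fix \<rho> assume \<rho>: "\<rho> \<in> \<Gamma>"
    note h = rat_hom_on_simps[OF hom[OF \<rho>]]
    have "\<rho> (poly.coeff P k) =
        (\<Sum>\<sigma>\<in>\<Gamma>. \<rho> (\<sigma> x) * \<rho> (poly.coeff (\<Prod>\<tau>\<in>\<Gamma> - {\<sigma>}. [:-\<tau> \<theta>, 1:]) k))"
      unfolding P using c x aut_in by (subst h(7)) (auto intro: rat_adjoin_mult simp: h(3))
    also have "\<dots> = (\<Sum>\<sigma>\<in>\<Gamma>. compose L \<rho> \<sigma> x *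
        poly.coeff (\<Prod>\<tau>\<in>\<Gamma> - {compose L \<rho> \<sigma>}. [:-\<tau> \<theta>, 1:]) k)"
    proof (rule sum.cong[OF refl], rule arg_cong2[where f = "(*)"])
      fix \<sigma> assume \<sigma>: "\<sigma> \<in> \<Gamma>"
      show "\<rho> (\<sigma> x) = compose L \<rho> \<sigma> x" using x by (simp add: compose_eq)
      have "bij_betw (compose L \<rho>) (\<Gamma> - {\<sigma>}) (\<Gamma> - {compose L \<rho> \<sigma>})"
        using bij_betw_DiffI[OF bij_betw_compose[OF \<rho>], of "{\<sigma>}" "{compose L \<rho> \<sigma>}"] \<sigma> aut_compose[OF \<rho> \<sigma>]
        by (simp add: bij_betw_def)
      from prod.reindex_bij_betw[OF this, of "\<lambda>\<tau>. [:-\<tau> \<theta>, 1:]"]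
      have "(\<Prod>\<tau>\<in>\<Gamma> - {compose L \<rho> \<sigma>}. [:-\<tau> \<theta>, 1:]) = (\<Prod>\<tau>\<in>\<Gamma> - {\<sigma>}. [:-\<rho> (\<tau> \<theta>), 1:])"
        using \<theta> by (simp add: compose_eq)
      then show "\<rho> (poly.coeff (\<Prod>\<tau>\<in>\<Gamma> - {\<sigma>}. [:-\<tau> \<theta>, 1:]) k) =
          poly.coeff (\<Prod>\<tau>\<in>\<Gamma> - {compose L \<rho> \<sigma>}. [:-\<tau> \<theta>, 1:]) k"
        using aut_coeff_prod_linear(2)[OF \<rho>, of "\<Gamma> - {\<sigma>}" "\<lambda>\<tau>. \<tau> \<theta>" k] finite_auts aut_in \<theta> by simp
    qed
    also have "\<dots> = poly.coeff P k"
      unfolding P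
      using sum.reindex_bij_betw[OF bij_betw_compose[OF \<rho>],
          of "\<lambda>\<sigma>. \<sigma> x * poly.coeff (\<Prod>\<tau>\<in>\<Gamma> - {\<sigma>}. [:-\<tau> \<theta>, 1:]) k"] .
    finally show "\<rho> (poly.coeff P k) = poly.coeff P k" .
  qed
  then show ?thesis by (simp add: poly_over_def rat_adjoin_empty)
qed

text \<open>
  Take \<open>\<theta>\<close> in \<open>\<rat>(T)\<close> with distinct conjugates. Lagrange interpolation expresses an arbitrary \<open>x \<in> L\<close>
  through \<open>\<theta>\<close>: the interpolation polynomials of \<open>x\<close> and of \<open>1\<close> are rational, and at \<open>\<theta>\<close> their
  quotient is \<open>x\<close>.
\<close>
lemma rat_adjoin_eq_if_separates:
  assumes T: "finite T" "T \<subseteq> L"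
    and sep: "\<And>\<sigma> \<tau>. \<sigma> \<in> \<Gamma> \<Longrightarrow> \<tau> \<in> \<Gamma> \<Longrightarrow> (\<And>t. t \<in> T \<Longrightarrow> \<sigma> t = \<tau> t) \<Longrightarrow> \<sigma> = \<tau>"
  shows "rat_adjoin T = L"
proof
  show "rat_adjoin T \<subseteq> L" using T(2) by (rule rat_adjoin_least)
  obtain \<theta> where \<theta>: "\<theta> \<in> rat_adjoin T" "\<theta> \<in> L"
    "\<And>\<sigma> \<tau>. \<sigma> \<in> \<Gamma> \<Longrightarrow> \<tau> \<in> \<Gamma> \<Longrightarrow> \<sigma> \<theta> = \<tau> \<theta> \<Longrightarrow> \<sigma> = \<tau>"
    using separating_element[OF T] sep by (metis IntE)
  let ?i = "restrict id L"
  define P where "P x = (\<Sum>\<sigma>\<in>\<Gamma>. Polynomial.smult (\<sigma> x) (\<Prod>\<tau>\<in>\<Gamma> - {\<sigma>}. [:-\<tau> \<theta>, 1:]))" for x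
  define d where "d = (\<Prod>\<tau>\<in>\<Gamma> - {?i}. \<theta> - \<tau> \<theta>)"
  have "\<theta> \<noteq> \<tau> \<theta>" if "\<tau> \<in> \<Gamma> - {?i}" for \<tau>
    using \<theta>(3)[OF id_aut, of \<tau>] that \<theta>(2) by auto
  then have "d \<noteq> 0" unfolding d_def using finite_auts by simp
  have val: "poly (P x) \<theta> = x * d" if x: "x \<in> L" for x
  proof -
    have "poly (P x) \<theta> = (\<Sum>\<sigma>\<in>\<Gamma>. \<sigma> x * (\<Prod>\<tau>\<in>\<Gamma> - {\<sigma>}. \<theta> - \<tau> \<theta>))"
      by (simp add: P_def poly_sum poly_prod)
    also have "\<dots> = ?i x * d + (\<Sum>\<sigma>\<in>\<Gamma> - {?i}. \<sigma> x * (\<Prod>\<tau>\<in>\<Gamma> - {\<sigma>}. \<theta> - \<tau> \<theta>))"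
      unfolding d_def by (rule sum.remove[OF finite_auts id_aut])
    also have "(\<Sum>\<sigma>\<in>\<Gamma> - {?i}. \<sigma> x * (\<Prod>\<tau>\<in>\<Gamma> - {\<sigma>}. \<theta> - \<tau> \<theta>)) = 0"
    proof (intro sum.neutral ballI)
      fix \<sigma> assume "\<sigma> \<in> \<Gamma> - {?i}"
      then have "?i \<in> \<Gamma> - {\<sigma>}" "\<theta> - ?i \<theta> = 0" using id_aut \<theta>(2) by auto
      then have "(\<Prod>\<tau>\<in>\<Gamma> - {\<sigma>}. \<theta> - \<tau> \<theta>) = 0"
        using finite_auts by (intro prod_zero) blast+
      then show "\<sigma> x * (\<Prod>\<tau>\<in>\<Gamma> - {\<sigma>}. \<theta> - \<tau> \<theta>) = 0" by simp
    qed
    finally show ?thesis using x by simp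
  qed
  have PT: "poly (P x) \<theta> \<in> rat_adjoin T" if "x \<in> L" for x
    using interpolation_poly_rational[OF \<theta>(2) that] \<theta>(1)
    unfolding P_def[symmetric] by (blast intro: poly_in_rat_adjoin poly_over_mono)
  show "L \<subseteq> rat_adjoin T"
  proof
    fix x assume x: "x \<in> L"
    have "x = poly (P x) \<theta> / poly (P 1) \<theta>"
      using val[OF x] val[of 1] \<open>d \<noteq> 0\<close> rat_adjoin_rat[of 1] by simp
    also have "\<dots> \<in> rat_adjoin T"
      using PT[OF x] PT[of 1] rat_adjoin_rat[of 1] by (intro rat_adjoin_divide) auto
    finally show "x \<in> rat_adjoin T" .
  qed
qed

end

section \<open>Counting polynomials with a given splitting field\<close>

text \<open>
  The constant \<open>9\<close> is \<open>4 * 2\<close> from \<open>\<bar>Re z\<bar> + \<bar>Im z\<bar> \<le> 2 * cmod z\<close>, plus \<open>1\<close> from rounding.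
\<close>
lemma floor_vector_bound:
  "real_of_int (max 1 \<bar>\<lfloor>4 * (Re z + Im z)\<rfloor>\<bar>) \<le> 9 * max 1 (cmod z)"
proof -
  have "\<bar>Re z\<bar> \<le> cmod z" "\<bar>Im z\<bar> \<le> cmod z" by (rule abs_Re_le_cmod abs_Im_le_cmod)+
  then have "\<bar>4 * (Re z + Im z)\<bar> \<le> 8 * cmod z" unfolding abs_le_iff by auto
  then have "real_of_int \<bar>\<lfloor>4 * (Re z + Im z)\<rfloor>\<bar> \<le> 8 * cmod z + 1"
    unfolding of_int_abs using floor_correct[of "4 * (Re z + Im z)"] by linarith
  moreover have "1 \<le> max 1 (cmod z)" "cmod z \<le> max 1 (cmod z)" by simp_all
  ultimately have "real_of_int \<bar>\<lfloor>4 * (Re z + Im z)\<rfloor>\<bar> \<le> 9 * max 1 (cmod z)"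
    "1 \<le> 9 * max 1 (cmod z)" by linarith+
  then show ?thesis unfolding of_int_max by simp
qed

lemma regular_galois_eqI:
  assumes "regular_galois f" "regular_galois g" "complex_roots f = complex_roots g"
  shows "f = g"
proof -
  have "map_poly of_int f = (map_poly of_int g :: complex poly)"
    using assms regular_galois.poly_eq_prod_roots by metis
  then show ?thesis by (simp add: poly_eq_iff coeff_map_poly)
qed

text \<open>
  The bound is uniform in the field \<open>K\<close>. In \<open>Y\<close>, the factor \<open>9 ^ n\<close> is the loss from rounding and the
  rest bounds the Mahler measure. A root of \<open>f\<close> is encoded by its rounded conjugates. If two
  roots have the same code, then all conjugates of their difference are small: for each \<open>\<sigma>\<close>, the
  automorphisms \<open>\<sigma>\<close> and \<open>cnj \<circ> \<sigma>\<close> control the sum and the difference of real and imaginary part.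
\<close>
lemma card_polys_with_splitting_field:
  fixes K :: "complex set" and n :: nat and H :: real
  assumes H: "H \<ge> 1"
  defines "F \<equiv> {f. regular_galois f \<and> Polynomial.degree f = n \<and> real_of_int (height f) \<le> H \<and>
      rat_adjoin (complex_roots f) = K}"
    and "Y \<equiv> 9 ^ n * (sqrt (real n + 1) * H)"
  shows "real (card F) \<le> Y * (3 + 2 * ln Y) ^ n"
proof (cases "F = {}")
  case True
  have "Y \<ge> 1" unfolding Y_def using H by (intro mult_ge1_I) (simp_all add: one_le_power)
  then show ?thesis unfolding True by (simp add: mult_nonneg_nonneg)
next
  case False
  have "Y \<ge> 1" unfolding Y_def using H by (intro mult_ge1_I) (simp_all add: one_le_power)
  define A where "A = field_auts K"
  have F: "regular_galois f" "Polynomial.degree f = n" "real_of_int (height f) \<le> H"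
    "rat_adjoin (complex_roots f) = K" if "f \<in> F" for f
    using that by (simp_all add: F_def)
  have A: "finite A" "card A = n"
    using False F regular_galois.finite_auts regular_galois.card_auts unfolding A_def by blast+
  define root where "root f = (SOME \<alpha>. \<alpha> \<in> complex_roots f)" for f
  have root: "root f \<in> complex_roots f" if "f \<in> F" for f
    using regular_galois.roots_nonempty[OF F(1)[OF that]] unfolding root_def by (rule some_in_eq[THEN iffD2])
  define v where "v f = (\<lambda>\<sigma>\<in>A. \<lfloor>4 * (Re (\<sigma> (root f)) + Im (\<sigma> (root f)))\<rfloor>)" for f
  let ?V = "{w \<in> A \<rightarrow>\<^sub>E (UNIV :: int set). (\<Prod>\<sigma>\<in>A. real_of_int (max 1 \<bar>w \<sigma>\<bar>)) \<le> Y}"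
  have "v ` F \<subseteq> ?V"
  proof (rule image_subsetI)
    fix f assume f: "f \<in> F"
    interpret regular_galois f using F(1)[OF f] .
    have "(\<Prod>\<sigma>\<in>A. real_of_int (max 1 \<bar>v f \<sigma>\<bar>)) \<le> (\<Prod>\<sigma>\<in>A. 9 * max 1 (cmod (\<sigma> (root f))))"
      using floor_vector_bound by (intro prod_mono) (simp add: v_def)
    also have "\<dots> = 9 ^ n * (\<Prod>\<sigma>\<in>A. max 1 (cmod (\<sigma> (root f))))"
      by (simp add: prod.distrib A)
    also have "(\<Prod>\<sigma>\<in>A. max 1 (cmod (\<sigma> (root f)))) = (\<Prod>z\<in>S. max 1 (cmod z))"
      using prod.reindex_bij_betw[OF bij_betw_conjugates[OF root[OF f]], of "\<lambda>z. max 1 (cmod z)"]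
      by (simp add: A_def F(4)[OF f])
    also have "9 ^ n * (\<Prod>z\<in>S. max 1 (cmod z)) \<le> Y"
      unfolding Y_def using prod_max_roots_le[OF F(3)[OF f]] H F(2)[OF f]
      by (intro mult_left_mono) auto
    finally show "v f \<in> ?V" by (simp add: v_def)
  qed
  moreover have "inj_on v F"
  proof (rule inj_onI)
    fix f g assume f: "f \<in> F" and g: "g \<in> F" and eq: "v f = v g"
    interpret regular_galois f using F(1)[OF f] .
    interpret g: regular_galois g using F(1)[OF g] .
    have K: "L = K" "g.L = K" using F(4) f g by auto
    let ?\<alpha> = "root f" and ?\<beta> = "root g"
    have in_L: "?\<alpha> \<in> L" "?\<beta> \<in> L" using roots_subset g.roots_subset root f g K by auto
    obtain R where R: "complex_roots f \<union> complex_roots g \<subseteq> R" "integral_ring R"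
      using integral_ring_exists[of "complex_roots f \<union> complex_roots g"]
        finite_roots g.finite_roots monic g.monic complex_roots_algebraic_int by (metis finite_UnI Un_iff)
    have diff: "\<sigma> (?\<alpha> - ?\<beta>) = \<sigma> ?\<alpha> - \<sigma> ?\<beta>" if "\<sigma> \<in> \<Gamma>" for \<sigma>
      using rat_hom_on_simps(5)[OF hom[OF that] in_L] .
    have close: "\<bar>Re (\<sigma> (?\<alpha> - ?\<beta>)) + Im (\<sigma> (?\<alpha> - ?\<beta>))\<bar> < 1 / 4" if \<sigma>: "\<sigma> \<in> \<Gamma>" for \<sigma>
    proof -
      have "v f \<sigma> = v g \<sigma>" using eq by simp
      then have "\<lfloor>4 * (Re (\<sigma> ?\<alpha>) + Im (\<sigma> ?\<alpha>))\<rfloor> = \<lfloor>4 * (Re (\<sigma> ?\<beta>) + Im (\<sigma> ?\<beta>))\<rfloor>"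
        using \<sigma> K by (simp add: v_def A_def)
      then have "\<bar>4 * (Re (\<sigma> ?\<alpha>) + Im (\<sigma> ?\<alpha>)) - 4 * (Re (\<sigma> ?\<beta>) + Im (\<sigma> ?\<beta>))\<bar> < 1" by linarith
      then show ?thesis unfolding diff[OF \<sigma>] minus_complex.sel abs_less_iff by auto
    qed
    have "?\<alpha> - ?\<beta> = 0"
    proof (rule norm_lt_1_imp_zero[OF R(2)])
      show "?\<alpha> - ?\<beta> \<in> L" using in_L by (rule rat_adjoin_diff)
      fix \<sigma> assume \<sigma>: "\<sigma> \<in> \<Gamma>"
      have "\<sigma> ?\<alpha> \<in> R" "\<sigma> ?\<beta> \<in> R"
        using aut_root[OF \<sigma> root[OF f]] g.aut_root[OF _ root[OF g], of \<sigma>] \<sigma> K R(1) by auto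
      then show "\<sigma> (?\<alpha> - ?\<beta>) \<in> R" unfolding diff[OF \<sigma>] using R(2) by (simp add: integral_ring_def)
      let ?z = "\<sigma> (?\<alpha> - ?\<beta>)"
      \<comment> \<open>Applying the previous bound to the complex conjugate automorphism
        changes the sign of the imaginary part.\<close>
      have "\<bar>Re ?z - Im ?z\<bar> < 1 / 4"
        using close[OF aut_cnj[OF \<sigma>]] rat_adjoin_diff[OF in_L] by simp
      then have "\<bar>Re ?z\<bar> + \<bar>Im ?z\<bar> < 1" using close[OF \<sigma>] by linarith
      then show "cmod ?z < 1" using cmod_le[of ?z] by linarith
    qed
    then have \<alpha>\<beta>: "?\<alpha> = ?\<beta>" by simp
    have "complex_roots f = (\<lambda>\<sigma>. \<sigma> ?\<alpha>) ` \<Gamma>"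
      using bij_betw_conjugates[OF root[OF f]] by (simp add: bij_betw_def)
    also have "\<dots> = complex_roots g"
      using g.bij_betw_conjugates[OF root[OF g]] K \<alpha>\<beta> by (simp add: bij_betw_def)
    finally show "f = g" using regular_galois_eqI F(1) f g by blast
  qed
  ultimately have "card F \<le> card ?V"
    using card_inj_on_le card_int_vectors_le(1)[OF A(1) \<open>Y \<ge> 1\<close>] by blast
  then show ?thesis
    using card_int_vectors_le(2)[OF A(1) \<open>Y \<ge> 1\<close>] unfolding A(2) by linarith
qed

section \<open>Orbit polynomials\<close>

lemma max_norm_prod_le:
  fixes z :: "'i \<Rightarrow> complex"
  shows "max 1 (cmod (\<Prod>i\<in>I. z i)) \<le> (\<Prod>i\<in>I. max 1 (cmod (z i)))"
proof -
  have "cmod (\<Prod>i\<in>I. z i) \<le> (\<Prod>i\<in>I. max 1 (cmod (z i)))"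
    unfolding prod_norm[symmetric] by (intro prod_mono) simp
  moreover have "1 \<le> (\<Prod>i\<in>I. max 1 (cmod (z i)))" by (intro prod_ge_1) simp
  ultimately show ?thesis by simp
qed

lemma max_norm_nat_diff_le: "max 1 (cmod (of_nat c - z)) \<le> (1 + real c) * max 1 (cmod z)"
proof -
  let ?m = "max 1 (cmod z)"
  have m: "1 \<le> ?m" "cmod z \<le> ?m" by simp_all
  have "cmod (of_nat c - z) \<le> real c + cmod z"
    using norm_triangle_ineq4[of "of_nat c" z] by simp
  also have "\<dots> \<le> real c * ?m + ?m"
    using m mult_left_mono[of 1 ?m "real c"] by simp
  finally have "cmod (of_nat c - z) \<le> (1 + real c) * ?m" by (simp add: algebra_simps)
  moreover have "1 * 1 \<le> (1 + real c) * ?m" using m by (intro mult_mono) simp_all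
  ultimately show ?thesis by simp
qed

lemma coeff_prod_linear_integral:
  assumes R: "integral_ring R" and z: "\<And>i. i \<in> I \<Longrightarrow> z i \<in> R"
  shows "poly.coeff (\<Prod>i\<in>I. [:-z i, 1:]) k \<in> R"
proof -
  have R': "1 \<in> R" "0 \<in> R" "\<And>x y. x \<in> R \<Longrightarrow> y \<in> R \<Longrightarrow> x - y \<in> R \<and> x * y \<in> R"
    using R unfolding integral_ring_def by (blast, metis diff_self, blast)
  show ?thesis
    using z
  proof (induction I arbitrary: k rule: infinite_finite_induct)
    case (insert i I)
    let ?p = "\<Prod>i\<in>I. [:-z i, 1:]"
    have IH: "poly.coeff ?p k \<in> R" for k using insert by simp
    then have "poly.coeff (pCons 0 ?p) k \<in> R" using R' by (cases k) simp_all
    then have "poly.coeff (pCons 0 ?p) k - z i * poly.coeff ?p k \<in> R"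
      using IH R'(3) insert.prems by simp
    moreover have "poly.coeff ([:-z i, 1:] * ?p) k = poly.coeff (pCons 0 ?p) k - z i * poly.coeff ?p k"
      by simp
    ultimately show ?case unfolding prod.insert[OF insert.hyps] by (simp only:)
  qed (use R' in \<open>simp_all add: coeff_1\<close>)
qed

lemma monic_polys_mono: "B \<le> B' \<Longrightarrow> monic_polys n B \<subseteq> monic_polys n B'"
  unfolding monic_polys_def by auto

lemma int_poly_of_Ints:
  fixes p :: "complex poly"
  assumes "\<And>k. poly.coeff p k \<in> \<int>"
  obtains h :: "int poly" where "map_poly of_int h = p"
proof (rule that[of "map_poly (\<lambda>x. \<lfloor>Re x\<rfloor>) p"])
  have "of_int \<lfloor>Re (poly.coeff p k)\<rfloor> = poly.coeff p k" for k
    using assms[of k] by (auto elim!: Ints_cases)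
  then show "map_poly of_int (map_poly (\<lambda>x. \<lfloor>Re x\<rfloor>) p) = p"
    by (intro poly_eqI) (simp add: coeff_map_poly)
qed

text \<open>
  A faithful action of the Galois group on a further finite set \<open>E\<close>, and a base point \<open>\<alpha>\<close> among the roots.
  In the application the action comes from an isomorphism with the abstract group, which depends on \<open>f\<close>.
\<close>
locale regular_galois_acting = regular_galois +
  fixes E :: "'e set" and act :: "(complex \<Rightarrow> complex) \<Rightarrow> 'e \<Rightarrow> 'e" and \<alpha> :: complex
  assumes finite_E: "finite E"
    and act_in: "\<sigma> \<in> \<Gamma> \<Longrightarrow> e \<in> E \<Longrightarrow> act \<sigma> e \<in> E"
    and act_inj: "\<sigma> \<in> \<Gamma> \<Longrightarrow> inj_on (act \<sigma>) E"
    and act_compose: "\<sigma> \<in> \<Gamma> \<Longrightarrow> \<tau> \<in> \<Gamma> \<Longrightarrow> e \<in> E \<Longrightarrow> act (compose L \<sigma> \<tau>) e = act \<sigma> (act \<tau> e)"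
    and act_faithful: "\<sigma> \<in> \<Gamma> \<Longrightarrow> \<tau> \<in> \<Gamma> \<Longrightarrow> (\<And>e. e \<in> E \<Longrightarrow> act \<sigma> e = act \<tau> e) \<Longrightarrow> \<sigma> = \<tau>"
    and \<alpha>: "\<alpha> \<in> S"
begin

text \<open>
  A coset of the stabilizer of \<open>r\<close>, or empty.
\<close>
definition transporter :: "'e \<Rightarrow> 'e \<Rightarrow> (complex \<Rightarrow> complex) set" where
  "transporter r e = {\<tau> \<in> \<Gamma>. act \<tau> r = e}"

text \<open>
  For \<open>e = r\<close> this is the norm of \<open>c - \<alpha>\<close> from \<open>L\<close> to the fixed field of the stabilizer of \<open>r\<close>; the
  other points of the orbit give its conjugates.
\<close>
definition relative_norm :: "nat \<Rightarrow> 'e \<Rightarrow> 'e \<Rightarrow> complex" where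
  "relative_norm c r e = (\<Prod>\<tau>\<in>transporter r e. of_nat c - \<tau> \<alpha>)"

definition galois_orbit :: "'e \<Rightarrow> 'e set" where
  "galois_orbit r = (\<lambda>\<tau>. act \<tau> r) ` \<Gamma>"

lemma finite_transporter: "finite (transporter r e)"
  using finite_auts by (simp add: transporter_def)

lemma conjugate_in: "\<tau> \<in> \<Gamma> \<Longrightarrow> \<tau> \<alpha> \<in> L"
  using aut_in \<alpha> roots_subset by blast

lemma relative_norm_in: "relative_norm c r e \<in> L"
  unfolding relative_norm_def transporter_def
  by (intro rat_adjoin_prod rat_adjoin_diff) (auto intro: rat_adjoin_rat conjugate_in)

lemma galois_orbit_subset: "r \<in> E \<Longrightarrow> galois_orbit r \<subseteq> E"
  using act_in by (auto simp: galois_orbit_def)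

lemma finite_galois_orbit: "finite (galois_orbit r)"
  using finite_auts by (simp add: galois_orbit_def)

lemma act_galois_orbit: "r \<in> E \<Longrightarrow> \<sigma> \<in> \<Gamma> \<Longrightarrow> e \<in> galois_orbit r \<Longrightarrow> act \<sigma> e \<in> galois_orbit r"
  using act_compose aut_compose by (force simp: galois_orbit_def)

lemma bij_betw_transporter:
  assumes \<sigma>: "\<sigma> \<in> \<Gamma>" and E: "r \<in> E" "e \<in> E"
  shows "bij_betw (compose L \<sigma>) (transporter r e) (transporter r (act \<sigma> e))"
proof -
  have iff: "compose L \<sigma> \<tau> \<in> transporter r (act \<sigma> e) \<longleftrightarrow> \<tau> \<in> transporter r e" if "\<tau> \<in> \<Gamma>" for \<tau>
    using that aut_compose[OF \<sigma> that] act_compose[OF \<sigma> that E(1)] inj_onD[OF act_inj[OF \<sigma>]]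
      act_in[OF that E(1)] E(2)
    by (auto simp: transporter_def)
  have "compose L \<sigma> ` transporter r e = transporter r (act \<sigma> e)"
  proof (intro equalityI subsetI)
    fix \<rho> assume \<rho>: "\<rho> \<in> transporter r (act \<sigma> e)"
    then have "\<rho> \<in> compose L \<sigma> ` \<Gamma>"
      using bij_betw_compose[OF \<sigma>] by (simp add: transporter_def bij_betw_def)
    then show "\<rho> \<in> compose L \<sigma> ` transporter r e" using iff \<rho> by blast
  qed (use iff in \<open>auto simp: transporter_def\<close>)
  moreover have "inj_on (compose L \<sigma>) (transporter r e)"
    using bij_betw_compose[OF \<sigma>] by (rule inj_on_subset[OF bij_betw_imp_inj_on]) (auto simp: transporter_def)
  ultimately show ?thesis by (simp add: bij_betw_def)
qed

lemma aut_relative_norm: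
  assumes \<sigma>: "\<sigma> \<in> \<Gamma>" and E: "r \<in> E" "e \<in> E"
  shows "\<sigma> (relative_norm c r e) = relative_norm c r (act \<sigma> e)"
proof -
  note h = rat_hom_on_simps[OF hom[OF \<sigma>]]
  have nat: "of_nat c \<in> L" by (simp add: rat_adjoin_rat)
  have tr: "\<tau> \<in> \<Gamma>" if "\<tau> \<in> transporter r e" for \<tau> using that by (simp add: transporter_def)
  have "\<sigma> (relative_norm c r e) = (\<Prod>\<tau>\<in>transporter r e. \<sigma> (of_nat c - \<tau> \<alpha>))"
    unfolding relative_norm_def using conjugate_in tr nat by (intro h(8) rat_adjoin_diff) blast+
  also have "\<dots> = (\<Prod>\<tau>\<in>transporter r e. of_nat c - compose L \<sigma> \<tau> \<alpha>)"
  proof (rule prod.cong[OF refl])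
    fix \<tau> assume "\<tau> \<in> transporter r e"
    then show "\<sigma> (of_nat c - \<tau> \<alpha>) = of_nat c - compose L \<sigma> \<tau> \<alpha>"
      using conjugate_in[OF tr] nat \<alpha> roots_subset by (simp add: h(1,5) compose_eq subset_iff)
  qed
  also have "\<dots> = relative_norm c r (act \<sigma> e)"
    unfolding relative_norm_def
    using prod.reindex_bij_betw[OF bij_betw_transporter[OF \<sigma> E], of "\<lambda>\<tau>. of_nat c - \<tau> \<alpha>"] .
  finally show ?thesis .
qed

text \<open>
  The group permutes the roots, so the coefficients are fixed and therefore rational; they are
  polynomial expressions in the roots of \<open>f\<close>, so they are integers.
\<close>
lemma orbit_poly_exists:
  assumes r: "r \<in> E"
  obtains h :: "int poly" where "map_poly of_int h = (\<Prod>e\<in>galois_orbit r. [:-relative_norm c r e, 1:])"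
proof -
  obtain R where R: "S \<subseteq> R" "integral_ring R"
    using integral_ring_exists[of S] monic finite_roots complex_roots_algebraic_int by metis
  have R': "1 \<in> R" "0 \<in> R" "\<And>x y. x \<in> R \<Longrightarrow> y \<in> R \<Longrightarrow> x - y \<in> R \<and> x * y \<in> R \<and> x + y \<in> R"
    using R(2) unfolding integral_ring_def by (blast, metis diff_self, blast)
  have nat: "of_nat c \<in> R" by (induction c) (use R' in simp_all)
  have prod_R: "(\<Prod>\<tau>\<in>A. of_nat c - \<tau> \<alpha>) \<in> R" if "A \<subseteq> \<Gamma>" for A
    using that
  proof (induction A rule: infinite_finite_induct)
    case (insert \<tau> A)
    have "\<tau> \<in> \<Gamma>" "A \<subseteq> \<Gamma>" using insert.prems by simp_all
    then have "\<tau> \<alpha> \<in> R" using subsetD[OF R(1) aut_root[OF _ \<alpha>]] by simp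
    then have "of_nat c - \<tau> \<alpha> \<in> R" using R'(3)[OF nat] by blast
    moreover have "(\<Prod>\<tau>\<in>A. of_nat c - \<tau> \<alpha>) \<in> R" by (rule insert.IH[OF \<open>A \<subseteq> \<Gamma>\<close>])
    ultimately show ?case unfolding prod.insert[OF insert.hyps] using R'(3) by blast
  qed (use R'(1) in simp_all)
  have "relative_norm c r e \<in> R" for e
    unfolding relative_norm_def by (rule prod_R) (auto simp: transporter_def)
  then have in_R: "poly.coeff (\<Prod>e\<in>galois_orbit r. [:-relative_norm c r e, 1:]) k \<in> R" for k
    by (intro coeff_prod_linear_integral[OF R(2)])
  have rat: "poly.coeff (\<Prod>e\<in>galois_orbit r. [:-relative_norm c r e, 1:]) k \<in> \<rat>" for k
  proof (rule fixed_rational)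
    show "poly.coeff (\<Prod>e\<in>galois_orbit r. [:-relative_norm c r e, 1:]) k \<in> L"
      using aut_coeff_prod_linear(1)[OF id_aut finite_galois_orbit[of r], of "relative_norm c r"] relative_norm_in
      by (simp add: poly_over_def)
    fix \<sigma> assume \<sigma>: "\<sigma> \<in> \<Gamma>"
    have "inj_on (act \<sigma>) (galois_orbit r)" using act_inj[OF \<sigma>] galois_orbit_subset[OF r] by (rule inj_on_subset)
    moreover have "act \<sigma> ` galois_orbit r \<subseteq> galois_orbit r" using act_galois_orbit[OF r \<sigma>] by blast
    ultimately have bij: "bij_betw (act \<sigma>) (galois_orbit r) (galois_orbit r)"
      using finite_galois_orbit by (simp add: bij_betw_def endo_inj_surj)
    have "\<sigma> (poly.coeff (\<Prod>e\<in>galois_orbit r. [:-relative_norm c r e, 1:]) k) =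
        poly.coeff (\<Prod>e\<in>galois_orbit r. [:-\<sigma> (relative_norm c r e), 1:]) k"
      using aut_coeff_prod_linear(2)[OF \<sigma> finite_galois_orbit[of r], of "relative_norm c r"] relative_norm_in by blast
    also have "(\<Prod>e\<in>galois_orbit r. [:-\<sigma> (relative_norm c r e), 1:]) = (\<Prod>e\<in>galois_orbit r. [:-relative_norm c r (act \<sigma> e), 1:])"
      using galois_orbit_subset[OF r] r by (intro prod.cong refl) (simp add: aut_relative_norm[OF \<sigma>] subset_iff)
    also have "\<dots> = (\<Prod>e\<in>galois_orbit r. [:-relative_norm c r e, 1:])"
      using prod.reindex_bij_betw[OF bij, of "\<lambda>e. [:-relative_norm c r e, 1:]"] .
    finally show "\<sigma> (poly.coeff (\<Prod>e\<in>galois_orbit r. [:-relative_norm c r e, 1:]) k) =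
        poly.coeff (\<Prod>e\<in>galois_orbit r. [:-relative_norm c r e, 1:]) k" .
  qed
  have "poly.coeff (\<Prod>e\<in>galois_orbit r. [:-relative_norm c r e, 1:]) k \<in> \<int>" for k
    using in_R rat R(2) unfolding integral_ring_def by blast
  then show thesis using int_poly_of_Ints that by blast
qed

text \<open>
  The transporters from \<open>r\<close> partition \<open>\<Gamma>\<close>, so each conjugate of \<open>\<alpha>\<close> contributes to a single factor on
  the left and the bound stays linear in \<open>H\<close>.
\<close>
lemma prod_max_relative_norm_le:
  assumes "real_of_int (height f) \<le> H" "0 \<le> H"
  shows "(\<Prod>e\<in>galois_orbit r. max 1 (cmod (relative_norm c r e)))
     \<le> (1 + real c) ^ Polynomial.degree f * (sqrt (real (Polynomial.degree f) + 1) * H)"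
proof -
  have "(\<Prod>e\<in>galois_orbit r. max 1 (cmod (relative_norm c r e))) \<le>
      (\<Prod>e\<in>galois_orbit r. \<Prod>\<tau>\<in>transporter r e. max 1 (cmod (of_nat c - \<tau> \<alpha>)))"
    unfolding relative_norm_def by (intro prod_mono conjI max_norm_prod_le) simp
  also have "\<dots> = (\<Prod>\<tau>\<in>\<Gamma>. max 1 (cmod (of_nat c - \<tau> \<alpha>)))"
    unfolding transporter_def galois_orbit_def using finite_auts by (intro prod.group) auto
  also have "\<dots> \<le> (\<Prod>\<tau>\<in>\<Gamma>. (1 + real c) * max 1 (cmod (\<tau> \<alpha>)))"
    by (intro prod_mono conjI max_norm_nat_diff_le) simp
  also have "\<dots> = (1 + real c) ^ Polynomial.degree f * (\<Prod>\<tau>\<in>\<Gamma>. max 1 (cmod (\<tau> \<alpha>)))"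
    by (simp add: prod.distrib card_auts)
  also have "(\<Prod>\<tau>\<in>\<Gamma>. max 1 (cmod (\<tau> \<alpha>))) = (\<Prod>z\<in>S. max 1 (cmod z))"
    using prod.reindex_bij_betw[OF bij_betw_conjugates[OF \<alpha>], of "\<lambda>z. max 1 (cmod z)"] .
  also have "(1 + real c) ^ Polynomial.degree f * (\<Prod>z\<in>S. max 1 (cmod z)) \<le>
      (1 + real c) ^ Polynomial.degree f * (sqrt (real (Polynomial.degree f) + 1) * H)"
    using prod_max_roots_le[OF assms] by (intro mult_left_mono) simp_all
  finally show ?thesis .
qed

lemma orbit_poly_in_monic_polys:
  assumes h: "map_poly of_int h = (\<Prod>e\<in>galois_orbit r. [:-relative_norm c r e, 1:])"
    and H: "real_of_int (height f) \<le> H" "0 \<le> H"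
  shows "h \<in> monic_polys (card (galois_orbit r)) (2 ^ card (galois_orbit r) *
    ((1 + real c) ^ Polynomial.degree f * (sqrt (real (Polynomial.degree f) + 1) * H)))"
proof -
  let ?p = "\<Prod>e\<in>galois_orbit r. [:-relative_norm c r e, 1:]"
  let ?B = "2 ^ card (galois_orbit r) *
    ((1 + real c) ^ Polynomial.degree f * (sqrt (real (Polynomial.degree f) + 1) * H))"
  have "Polynomial.degree ?p = (\<Sum>e\<in>galois_orbit r. 1)"
    by (subst degree_prod_eq_sum_degree) auto
  moreover have "Polynomial.degree (map_poly of_int h :: complex poly) = Polynomial.degree h"
    by (simp add: degree_map_poly)
  ultimately have deg: "Polynomial.degree h = card (galois_orbit r)" using h by simp
  have "lead_coeff ?p = 1" by (simp add: lead_coeff_prod)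
  moreover have "lead_coeff (map_poly of_int h :: complex poly) = of_int (lead_coeff h)"
    by (simp add: degree_map_poly coeff_map_poly)
  ultimately have lead: "lead_coeff h = 1" using h by simp
  have bound: "real_of_int \<bar>poly.coeff h k\<bar> \<le> ?B" for k
  proof -
    have "real_of_int \<bar>poly.coeff h k\<bar> = cmod (poly.coeff (map_poly of_int h) k)"
      by (simp add: coeff_map_poly)
    also have "\<dots> \<le> (\<Prod>e\<in>galois_orbit r. 1 + cmod (relative_norm c r e))"
      unfolding h by (rule norm_coeff_prod_linear_le[OF finite_galois_orbit])
    also have "\<dots> \<le> (\<Prod>e\<in>galois_orbit r. 2 * max 1 (cmod (relative_norm c r e)))"
      by (intro prod_mono) (simp add: max_def)
    also have "\<dots> = 2 ^ card (galois_orbit r) * (\<Prod>e\<in>galois_orbit r. max 1 (cmod (relative_norm c r e)))"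
      by (simp add: prod.distrib)
    also have "\<dots> \<le> ?B" using prod_max_relative_norm_le[OF H] by (intro mult_left_mono) simp_all
    finally show ?thesis .
  qed
  have "height h \<in> (\<lambda>i. \<bar>poly.coeff h i\<bar>) ` {..Polynomial.degree h}"
    unfolding height_def by (intro Max_in) auto
  then have "real_of_int (height h) \<le> ?B" using bound by auto
  then show ?thesis using deg lead by (simp add: monic_polys_def)
qed

text \<open>
  Two relative norms attached to the same \<open>r\<close> are values at \<open>c\<close> of monic polynomials with disjoint
  sets of roots, so they coincide for at most \<open>n\<close> values of \<open>c\<close>. Each triple of points excludes that
  many.
\<close>
lemma separating_shift:
  "\<exists>c \<le> card E ^ 3 * Polynomial.degree f. \<forall>r\<in>E. \<forall>e\<in>galois_orbit r. \<forall>e'\<in>galois_orbit r. relative_norm c r e = relative_norm c r e' \<longrightarrow> e = e'"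
proof -
  let ?n = "Polynomial.degree f"
  define g where "g r e = (\<Prod>\<tau>\<in>transporter r e. [:-\<tau> \<alpha>, 1:])" for r e
  define T where "T = {(r, e, e'). r \<in> E \<and> e \<in> galois_orbit r \<and> e' \<in> galois_orbit r \<and> e \<noteq> e'}"
  define bad where "bad = (\<lambda>(r, e, e'). {c::nat. poly (g r e - g r e') (of_nat c) = 0})"
  have T_sub: "T \<subseteq> E \<times> E \<times> E" using galois_orbit_subset by (auto simp: T_def)
  then have finT: "finite T" using finite_E by (meson finite_SigmaI finite_subset)
  have "card T \<le> card (E \<times> E \<times> E)" using T_sub finite_E by (intro card_mono) auto
  then have cardT: "card T \<le> card E ^ 3" by (simp add: card_cartesian_product power3_eq_cube)
  have deg_g: "Polynomial.degree (g r e) \<le> ?n" for r e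
  proof -
    have "Polynomial.degree (g r e) = card (transporter r e)"
      unfolding g_def by (subst degree_prod_eq_sum_degree) auto
    also have "\<dots> \<le> ?n"
      unfolding card_auts[symmetric] using finite_auts by (intro card_mono) (auto simp: transporter_def)
    finally show ?thesis .
  qed
  have bad: "finite (bad t) \<and> card (bad t) \<le> ?n" if "t \<in> T" for t
  proof -
    obtain r e e' where t: "t = (r, e, e')" "r \<in> E" "e \<in> galois_orbit r" "e \<noteq> e'"
      using \<open>t \<in> T\<close> unfolding T_def by blast
    obtain \<tau> where \<tau>: "\<tau> \<in> \<Gamma>" "act \<tau> r = e" using t(3) by (auto simp: galois_orbit_def)
    have "poly (g r e) (\<tau> \<alpha>) = 0"
      unfolding g_def poly_prod using \<tau> finite_transporter by (intro prod_zero) (auto simp: transporter_def)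
    moreover have "poly (g r e') (\<tau> \<alpha>) \<noteq> 0"
    proof -
      have "\<tau> \<alpha> \<noteq> \<rho> \<alpha>" if "\<rho> \<in> transporter r e'" for \<rho>
        using that \<tau> t(4) bij_betw_imp_inj_on[OF bij_betw_conjugates[OF \<alpha>]]
        by (auto simp: transporter_def dest: inj_onD)
      then show ?thesis unfolding g_def poly_prod using finite_transporter by simp
    qed
    ultimately have nz: "g r e - g r e' \<noteq> 0" by (metis diff_eq_diff_eq diff_self poly_diff)
    let ?Z = "{z. poly (g r e - g r e') z = 0}"
    have fin: "finite ?Z" using nz by (rule poly_roots_finite)
    have sub: "(of_nat :: nat \<Rightarrow> complex) ` bad t \<subseteq> ?Z" by (auto simp: bad_def t)
    have inj: "inj_on (of_nat :: nat \<Rightarrow> complex) (bad t)" by (simp add: inj_on_def)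
    have "card (bad t) \<le> card ?Z" using inj sub fin by (rule card_inj_on_le)
    also have "\<dots> \<le> Polynomial.degree (g r e - g r e')" using nz by (rule card_poly_roots_bound)
    also have "\<dots> \<le> ?n" using deg_g by (intro degree_diff_le)
    finally show ?thesis using finite_subset[OF sub fin] finite_imageD inj by blast
  qed
  have "card (\<Union>t\<in>T. bad t) \<le> (\<Sum>t\<in>T. card (bad t))" using finT by (rule card_UN_le)
  also have "\<dots> \<le> card T * ?n" using sum_bounded_above[of T "\<lambda>t. card (bad t)" ?n] bad by simp
  also have "\<dots> \<le> card E ^ 3 * ?n" using cardT by (rule mult_le_mono1)
  finally have "card (\<Union>t\<in>T. bad t) < card {0..card E ^ 3 * ?n}" by simp
  moreover have "finite (\<Union>t\<in>T. bad t)" using finT bad by blast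
  ultimately have "\<not> {0..card E ^ 3 * ?n} \<subseteq> (\<Union>t\<in>T. bad t)"
    using card_mono[of "\<Union>t\<in>T. bad t" "{0..card E ^ 3 * ?n}"] by linarith
  then obtain c where c: "c \<in> {0..card E ^ 3 * ?n}" "c \<notin> (\<Union>t\<in>T. bad t)" by blast
  have "poly (g r e) (of_nat c) = relative_norm c r e" for r e
    by (simp add: g_def relative_norm_def poly_prod)
  then have bad_iff: "c \<in> bad (r, e, e') \<longleftrightarrow> relative_norm c r e = relative_norm c r e'" for r e e'
    by (simp add: bad_def)
  have "e = e'" if "r \<in> E" "e \<in> galois_orbit r" "e' \<in> galois_orbit r" "relative_norm c r e = relative_norm c r e'" for r e e'
  proof (rule ccontr)
    assume "e \<noteq> e'"
    then have "(r, e, e') \<in> T" using that by (simp add: T_def)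
    then show False using c(2) bad_iff that(4) by blast
  qed
  moreover have "c \<le> card E ^ 3 * ?n" using c(1) by simp
  ultimately show ?thesis by blast
qed

text \<open>
  If two automorphisms agree on all roots of the orbit polynomials, then, the relative norms being
  distinct within each orbit, they move every point of \<open>E\<close> in the same way and are equal. In \<open>B\<close>, the power of \<open>2\<close> passes from
  the Mahler measure of an orbit polynomial to its coefficients, the next factor is the cost of
  shifting the roots of \<open>f\<close> by \<open>c\<close>, and the last one bounds the Mahler measure of \<open>f\<close>.
\<close>
lemma orbit_polys_generate:
  assumes H: "real_of_int (height f) \<le> H" "0 \<le> H"
    and orbits: "\<And>Q. Q \<in> \<O> \<Longrightarrow> \<exists>r\<in>E. Q = galois_orbit r" "\<Union>\<O> = E"
    and finite: "finite \<O>"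
  defines "B \<equiv> 2 ^ card E * ((1 + real (card E ^ 3 * Polynomial.degree f)) ^ Polynomial.degree f *
      (sqrt (real (Polynomial.degree f) + 1) * H))"
  shows "\<exists>h \<in> (\<Pi>\<^sub>E Q\<in>\<O>. monic_polys (card Q) B). rat_adjoin (\<Union>Q\<in>\<O>. complex_roots (h Q)) = L"
proof -
  obtain c where c: "c \<le> card E ^ 3 * Polynomial.degree f"
    "\<And>r e e'. r \<in> E \<Longrightarrow> e \<in> galois_orbit r \<Longrightarrow> e' \<in> galois_orbit r \<Longrightarrow> relative_norm c r e = relative_norm c r e' \<Longrightarrow> e = e'"
    using separating_shift by blast
  have "\<forall>Q\<in>\<O>. \<exists>r h. r \<in> E \<and> Q = galois_orbit r \<and> map_poly of_int h = (\<Prod>e\<in>galois_orbit r. [:-relative_norm c r e, 1:])"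
    using orbits(1) orbit_poly_exists by metis
  then obtain rep h where rep: "\<And>Q. Q \<in> \<O> \<Longrightarrow> rep Q \<in> E" "\<And>Q. Q \<in> \<O> \<Longrightarrow> Q = galois_orbit (rep Q)"
    and h: "\<And>Q. Q \<in> \<O> \<Longrightarrow> map_poly of_int (h Q) = (\<Prod>e\<in>galois_orbit (rep Q). [:-relative_norm c (rep Q) e, 1:])"
    by metis
  have roots: "complex_roots (h Q) = relative_norm c (rep Q) ` Q" if "Q \<in> \<O>" for Q
  proof -
    have "poly (map_poly of_int (h Q)) z = 0 \<longleftrightarrow> (\<exists>e\<in>Q. z = relative_norm c (rep Q) e)" for z
      unfolding h[OF that] poly_prod rep(2)[OF that, symmetric]
      using finite_galois_orbit[of "rep Q"] rep(2)[OF that] by simp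
    then show ?thesis unfolding complex_roots_def by blast
  qed
  have "h Q \<in> monic_polys (card Q) B" if "Q \<in> \<O>" for Q
  proof -
    have "card Q \<le> card E"
      using rep[OF that] galois_orbit_subset finite_E by (metis card_mono)
    then have "2 ^ card Q * ((1 + real c) ^ Polynomial.degree f *
        (sqrt (real (Polynomial.degree f) + 1) * H)) \<le> B"
      unfolding B_def using c(1) H(2)
      by (intro mult_mono power_mono power_increasing) (simp_all del: of_nat_mult of_nat_power)
    moreover have "h Q \<in> monic_polys (card Q) (2 ^ card Q * ((1 + real c) ^ Polynomial.degree f *
        (sqrt (real (Polynomial.degree f) + 1) * H)))"
      using orbit_poly_in_monic_polys[OF h[OF that] H] rep(2)[OF that] by simp
    ultimately show ?thesis using monic_polys_mono by blast
  qed
  moreover have "rat_adjoin (\<Union>Q\<in>\<O>. complex_roots (h Q)) = L"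
  proof (rule rat_adjoin_eq_if_separates)
    show "finite (\<Union>Q\<in>\<O>. complex_roots (h Q))"
      using finite roots rep(2) finite_galois_orbit by (metis finite_UN_I finite_imageI)
    show "(\<Union>Q\<in>\<O>. complex_roots (h Q)) \<subseteq> L" using roots relative_norm_in by auto
    fix \<sigma> \<tau> assume \<sigma>\<tau>: "\<sigma> \<in> \<Gamma>" "\<tau> \<in> \<Gamma>"
      and eq: "\<And>t. t \<in> (\<Union>Q\<in>\<O>. complex_roots (h Q)) \<Longrightarrow> \<sigma> t = \<tau> t"
    show "\<sigma> = \<tau>"
    proof (rule act_faithful[OF \<sigma>\<tau>])
      fix e assume e: "e \<in> E"
      then obtain Q where Q: "Q \<in> \<O>" "e \<in> Q" using orbits(2) by blast
      let ?r = "rep Q"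
      have r: "?r \<in> E" "e \<in> galois_orbit ?r" using rep Q by auto
      have "\<sigma> (relative_norm c ?r e) = \<tau> (relative_norm c ?r e)" using eq roots Q by blast
      then have "relative_norm c ?r (act \<sigma> e) = relative_norm c ?r (act \<tau> e)"
        using aut_relative_norm \<sigma>\<tau> r(1) e by simp
      then show "act \<sigma> e = act \<tau> e" using c(2) r act_galois_orbit \<sigma>\<tau> by blast
    qed
  qed
  ultimately show ?thesis
    using roots by (intro bexI[of _ "restrict h \<O>"]) auto
qed

end

section \<open>The count\<close>

lemma carrier_galois_group: "carrier (galois_group f) = field_auts (rat_adjoin (complex_roots f))"
  by (simp add: galois_group_def splitting_field_def field_auts_def rat_adjoin_def)

lemma mult_galois_group:
  assumes "\<sigma> \<in> carrier (galois_group f)" "\<tau> \<in> carrier (galois_group f)"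
  shows "\<sigma> \<otimes>\<^bsub>galois_group f\<^esub> \<tau> = compose (rat_adjoin (complex_roots f)) \<sigma> \<tau>"
  using assms
  by (simp add: galois_group_def Gal_def BijGroup_def splitting_field_def rat_adjoin_def)

lemma card_monic_polys_le:
  assumes "B \<ge> 0"
  shows "real (card (monic_polys k B)) \<le> (2 * B + 1) ^ k"
proof -
  let ?A = "{- \<lfloor>B\<rfloor> .. \<lfloor>B\<rfloor>}"
  let ?c = "\<lambda>h :: int poly. restrict (poly.coeff h) {..<k}"
  have "?c ` monic_polys k B \<subseteq> {..<k} \<rightarrow>\<^sub>E ?A"
  proof (intro image_subsetI restrict_PiE_iff[THEN iffD2] ballI)
    fix h i assume h: "h \<in> monic_polys k B" and i: "i \<in> {..<k}"
    have "\<bar>poly.coeff h i\<bar> \<le> height h"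
      unfolding height_def using h i by (intro Max_ge) (auto simp: monic_polys_def)
    also have "height h \<le> \<lfloor>B\<rfloor>" using h by (simp add: monic_polys_def le_floor_iff)
    finally show "poly.coeff h i \<in> ?A" by (simp add: abs_le_iff)
  qed
  moreover have "inj_on ?c (monic_polys k B)"
  proof (intro inj_onI poly_eqI)
    fix h g i assume h: "h \<in> monic_polys k B" and g: "g \<in> monic_polys k B" and eq: "?c h = ?c g"
    consider "i < k" | "i = k" | "i > k" by linarith
    then show "poly.coeff h i = poly.coeff g i"
    proof cases
      case 1
      then show ?thesis using fun_cong[OF eq, of i] by simp
    qed (use h g in \<open>auto simp: monic_polys_def coeff_eq_0\<close>)
  qed
  ultimately have "card (monic_polys k B) \<le> card ({..<k} \<rightarrow>\<^sub>E ?A)"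
    by (intro card_inj_on_le finite_PiE) auto
  also have "\<dots> = nat (2 * \<lfloor>B\<rfloor> + 1) ^ k" by (simp add: card_PiE)
  finally have "real (card (monic_polys k B)) \<le> real (nat (2 * \<lfloor>B\<rfloor> + 1)) ^ k"
    by (metis of_nat_le_iff of_nat_power)
  also have "\<dots> \<le> (2 * B + 1) ^ k"
  proof (intro power_mono)
    have "real (nat (2 * \<lfloor>B\<rfloor> + 1)) = real_of_int (2 * \<lfloor>B\<rfloor> + 1)"
      using assms by (intro of_nat_nat) simp
    then show "real (nat (2 * \<lfloor>B\<rfloor> + 1)) \<le> 2 * B + 1" by simp
  qed simp
  finally show ?thesis .
qed

context regular_perm_group
begin

lemma regular_galois_if_isomorphic:
  assumes "f \<in> polys_with_group H G E \<phi>"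
  shows "regular_galois f" and "Polynomial.degree f = card E" and "real_of_int (height f) \<le> H"
    and "\<exists>h. h \<in> iso (galois_group f) G"
proof -
  let ?S = "complex_roots f" and ?G = "galois_group f"
  have f: "lead_coeff f = 1" "Polynomial.degree f = card E" "real_of_int (height f) \<le> H" "separable f"
    using assms unfolding polys_with_group_def monic_polys_def by blast+
  then show "Polynomial.degree f = card E" "real_of_int (height f) \<le> H" by blast+
  obtain h b where h: "h \<in> iso ?G G" and b: "bij_betw b ?S E"
    and hb: "\<And>\<sigma> \<omega>. \<sigma> \<in> carrier ?G \<Longrightarrow> \<omega> \<in> ?S \<Longrightarrow> \<phi> (h \<sigma>) (b \<omega>) = b (galois_action f \<sigma> \<omega>)"
    using assms unfolding polys_with_group_def perm_group_isomorphic_def by blast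
  have h_bij: "bij_betw h (carrier ?G) (carrier G)" using h by (simp add: iso_def)
  show "regular_galois f"
  proof
    show "finite (field_auts (rat_adjoin ?S))"
      using h_bij finite_group bij_betw_finite unfolding carrier_galois_group by blast
    show "card (field_auts (rat_adjoin ?S)) = Polynomial.degree f"
      using bij_betw_same_card[OF h_bij] card_eq f(2) unfolding carrier_galois_group by simp
    fix \<alpha> \<beta> assume \<alpha>\<beta>: "\<alpha> \<in> ?S" "\<beta> \<in> ?S"
    have "b \<alpha> \<in> E" "b \<beta> \<in> E" using b \<alpha>\<beta> bij_betwE by blast+
    then obtain g where g: "g \<in> carrier G" "\<phi> g (b \<alpha>) = b \<beta>" using unique_orbit by blast
    then have "g \<in> h ` carrier ?G" using h_bij by (simp add: bij_betw_def)
    then obtain \<sigma> where \<sigma>: "\<sigma> \<in> carrier ?G" "h \<sigma> = g" by blast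
    have "b (\<sigma> \<alpha>) = b \<beta>"
      using hb[OF \<sigma>(1) \<alpha>\<beta>(1)] g(2) \<sigma>(2) \<alpha>\<beta>(1) by (simp add: galois_action_def)
    moreover have "\<sigma> \<alpha> \<in> ?S"
      using \<sigma>(1) rat_hom_on_permutes_roots[OF f(1) field_autsD(3)] \<alpha>\<beta>(1)
      unfolding carrier_galois_group by blast
    ultimately have "\<sigma> \<alpha> = \<beta>" using b \<alpha>\<beta>(2) by (auto simp: bij_betw_def dest: inj_onD)
    then show "\<exists>\<sigma>\<in>field_auts (rat_adjoin ?S). \<sigma> \<alpha> = \<beta>"
      using \<sigma>(1) unfolding carrier_galois_group by blast
  qed (use f in simp_all)
  show "\<exists>h. h \<in> iso ?G G" using h by blast
qed

text \<open>
  The minimal degree is defined by actions on sets of natural numbers; relabelling the points of the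
  given action shows that the minimum is taken over a nonempty set.
\<close>
lemma faithful_action_on_nats:
  "\<exists>(E' :: nat set) \<psi>. finite E' \<and> card E' = card E \<and> faithful_action G E' \<psi>"
proof -
  obtain b where b: "bij_betw b E {..<card E}"
    using ex_bij_betw_finite_nat[OF finite_points] by (auto simp: lessThan_atLeast0)
  let ?N = "{..<card E}"
  define c where "c = inv_into E b"
  have c: "c i \<in> E" "b (c i) = i" if "i \<in> ?N" for i
    using b that bij_betw_inv_into_right[OF b] by (auto simp: c_def bij_betw_def inv_into_into)
  have cb: "c (b e) = e" if "e \<in> E" for e
    using bij_betw_inv_into_left[OF b that] by (simp add: c_def)
  have bE: "b e \<in> ?N" if "e \<in> E" for e using b that bij_betwE by blast
  define \<psi> where "\<psi> g = (\<lambda>i\<in>?N. b (\<phi> g (c i)))" for g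
  interpret G: group G using group_hom group_hom.axioms(1) by blast
  have \<phi>: "\<phi> g e \<in> E" if "g \<in> carrier G" "e \<in> E" for g e
    using element_image that by blast
  have \<psi>_in: "\<psi> g i \<in> ?N" if "g \<in> carrier G" "i \<in> ?N" for g i
    using \<phi> bE c that by (simp add: \<psi>_def)
  have Bij: "\<psi> g \<in> Bij ?N" if g: "g \<in> carrier G" for g
  proof -
    have "inj_on (\<psi> g) ?N"
    proof (rule inj_onI)
      fix i j assume ij: "i \<in> ?N" "j \<in> ?N" "\<psi> g i = \<psi> g j"
      then have "c (b (\<phi> g (c i))) = c (b (\<phi> g (c j)))" by (simp add: \<psi>_def)
      then have "\<phi> g (c i) = \<phi> g (c j)" using ij c \<phi> g cb by simp
      then have "c i = c j" using inj_prop[OF g] c ij by (auto dest: inj_onD)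
      then show "i = j" using c ij by metis
    qed
    moreover have "\<psi> g ` ?N \<subseteq> ?N" using \<psi>_in g by blast
    ultimately have "bij_betw (\<psi> g) ?N ?N" by (simp add: bij_betw_def endo_inj_surj)
    then show ?thesis by (simp add: Bij_def \<psi>_def)
  qed
  have "\<psi> \<in> hom G (BijGroup ?N)"
  proof (rule homI)
    fix g g' assume g: "g \<in> carrier G" "g' \<in> carrier G"
    have "\<psi> (g \<otimes> g') = compose ?N (\<psi> g) (\<psi> g')"
    proof
      fix i
      show "\<psi> (g \<otimes> g') i = compose ?N (\<psi> g) (\<psi> g') i"
      proof (cases "i \<in> ?N")
        case True
        then have "\<psi> (g \<otimes> g') i = b (\<phi> g (\<phi> g' (c i)))"
          using c g by (simp add: \<psi>_def composition_rule)
        also have "\<dots> = \<psi> g (\<psi> g' i)"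
          using True \<psi>_in[OF g(2) True] c(1)[OF True] g by (simp add: \<psi>_def cb \<phi>)
        finally show ?thesis using True by (simp add: compose_eq)
      qed (simp add: \<psi>_def compose_def)
    qed
    then show "\<psi> (g \<otimes> g') = \<psi> g \<otimes>\<^bsub>BijGroup ?N\<^esub> \<psi> g'"
      using Bij g by (simp add: BijGroup_def)
  qed (use Bij in \<open>simp add: BijGroup_def\<close>)
  then have "group_hom G (BijGroup ?N) \<psi>"
    by (intro group_hom.intro group_hom_axioms.intro group_BijGroup G.group_axioms)
  moreover have "inj_on \<psi> (carrier G)"
  proof (rule inj_onI)
    fix g g' assume g: "g \<in> carrier G" "g' \<in> carrier G" "\<psi> g = \<psi> g'"
    have "\<phi> g = \<phi> g'"
    proof (rule extensionalityI[of _ E])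
      show "\<phi> g \<in> extensional E" "\<phi> g' \<in> extensional E"
        using bij_prop0 g by (auto simp: Bij_def)
      fix e assume e: "e \<in> E"
      have "\<psi> g (b e) = \<psi> g' (b e)" using g(3) by simp
      then have "c (b (\<phi> g e)) = c (b (\<phi> g' e))" using bE[OF e] cb[OF e] by (simp add: \<psi>_def)
      then show "\<phi> g e = \<phi> g' e" using \<phi> g e cb by simp
    qed
    then show "g = g'" using faithful g by (auto dest: inj_onD)
  qed
  ultimately have "faithful_action G ?N \<psi>"
    by (intro faithful_action.intro group_action.intro faithful_action_axioms.intro)
  then show ?thesis by (intro exI[of _ ?N]) auto
qed

lemma min_faithful_degree_attained:
  obtains E' :: "nat set" and \<psi>
  where "finite E'" "card E' = min_faithful_degree G" "faithful_action G E' \<psi>"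
proof -
  interpret G: group G using group_hom group_hom.axioms(1) by blast
  have "card E \<ge> 1"
    unfolding card_eq[symmetric] using G.one_closed finite_group
    by (metis One_nat_def Suc_leI card_gt_0_iff empty_iff)
  then have "\<exists>m\<ge>1. \<exists>(E' :: nat set) \<psi>. finite E' \<and> card E' = m \<and> faithful_action G E' \<psi>"
    using faithful_action_on_nats by blast
  from LeastI_ex[OF this] show thesis
    unfolding min_faithful_degree_def[symmetric] using that by blast
qed

lemma splitting_field_from_orbit_polys:
  fixes E' :: "'d set"
  assumes act: "faithful_action G E' \<psi>" and fin: "finite E'"
    and f: "f \<in> polys_with_group H G E \<phi>" and H: "H \<ge> 1"
  defines "B \<equiv> 2 ^ card E' * ((1 + real (card E' ^ 3 * card E)) ^ card E * (sqrt (real (card E) + 1) * H))"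
  shows "\<exists>h \<in> (\<Pi>\<^sub>E Q\<in>orbits G E' \<psi>. monic_polys (card Q) B).
    rat_adjoin (\<Union>Q\<in>orbits G E' \<psi>. complex_roots (h Q)) = rat_adjoin (complex_roots f)"
proof -
  note facts = regular_galois_if_isomorphic[OF f]
  interpret R: regular_galois f using facts(1) .
  interpret A: faithful_action G E' \<psi> using act .
  obtain h where h: "h \<in> iso (galois_group f) G" using facts(4) by blast
  have h_bij: "bij_betw h R.\<Gamma> (carrier G)"
    using h unfolding carrier_galois_group[symmetric] by (simp add: iso_def)
  have h_in: "h \<sigma> \<in> carrier G" if "\<sigma> \<in> R.\<Gamma>" for \<sigma> using h_bij that bij_betwE by blast
  have h_mult: "h (compose R.L \<sigma> \<tau>) = h \<sigma> \<otimes> h \<tau>" if "\<sigma> \<in> R.\<Gamma>" "\<tau> \<in> R.\<Gamma>" for \<sigma> \<tau>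
  proof -
    have \<sigma>\<tau>: "\<sigma> \<in> carrier (galois_group f)" "\<tau> \<in> carrier (galois_group f)"
      using that by (simp_all add: carrier_galois_group)
    have "h \<in> hom (galois_group f) G" using h by (simp add: iso_def)
    from hom_mult[OF this \<sigma>\<tau>] show ?thesis unfolding mult_galois_group[OF \<sigma>\<tau>] .
  qed
  obtain \<alpha> where \<alpha>: "\<alpha> \<in> complex_roots f" using R.roots_nonempty by blast
  interpret O: regular_galois_acting f E' "\<lambda>\<sigma>. \<psi> (h \<sigma>)" \<alpha>
  proof
    show "\<psi> (h \<sigma>) e \<in> E'" if "\<sigma> \<in> R.\<Gamma>" "e \<in> E'" for \<sigma> e
      using A.element_image h_in that by blast
    show "inj_on (\<psi> (h \<sigma>)) E'" if "\<sigma> \<in> R.\<Gamma>" for \<sigma>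
      using A.inj_prop h_in that by blast
    show "\<psi> (h (compose R.L \<sigma> \<tau>)) e = \<psi> (h \<sigma>) (\<psi> (h \<tau>) e)"
      if "\<sigma> \<in> R.\<Gamma>" "\<tau> \<in> R.\<Gamma>" "e \<in> E'" for \<sigma> \<tau> e
      using A.composition_rule h_in h_mult that by simp
    show "\<sigma> = \<tau>"
      if \<sigma>\<tau>: "\<sigma> \<in> R.\<Gamma>" "\<tau> \<in> R.\<Gamma>" and eq: "\<And>e. e \<in> E' \<Longrightarrow> \<psi> (h \<sigma>) e = \<psi> (h \<tau>) e" for \<sigma> \<tau>
    proof -
      have "\<psi> (h \<sigma>) = \<psi> (h \<tau>)"
        using A.bij_prop0 h_in \<sigma>\<tau> eq by (intro extensionalityI[of _ E']) (auto simp: Bij_def)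
      then have "h \<sigma> = h \<tau>" using A.faithful h_in \<sigma>\<tau> by (auto dest: inj_onD)
      then show ?thesis using h_bij \<sigma>\<tau> by (auto simp: bij_betw_def dest: inj_onD)
    qed
  qed (use fin \<alpha> in simp_all)
  have orbit_eq: "orbit G \<psi> r = O.galois_orbit r" for r
  proof -
    have "orbit G \<psi> r = (\<lambda>g. \<psi> g r) ` carrier G" unfolding orbit_def by blast
    also have "carrier G = h ` R.\<Gamma>" using h_bij by (simp add: bij_betw_def)
    finally show ?thesis by (simp add: O.galois_orbit_def image_image)
  qed
  have orbits_eq: "orbits G E' \<psi> = O.galois_orbit ` E'"
    unfolding orbits_def orbit_eq by blast
  have "\<Union>(orbits G E' \<psi>) = E'" by (rule A.orbits_coverture)
  moreover have "finite (orbits G E' \<psi>)" unfolding orbits_eq using fin by simp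
  moreover have "\<exists>r\<in>E'. Q = O.galois_orbit r" if "Q \<in> orbits G E' \<psi>" for Q
    using that unfolding orbits_eq by blast
  ultimately show ?thesis
    using O.orbit_polys_generate[OF facts(3), of "orbits G E' \<psi>"] H
    unfolding facts(2) B_def by simp
qed

text \<open>
  The product of the two counts: at most \<open>(2 * a + 1) ^ \<mu> * H ^ \<mu>\<close> families of orbit polynomials, and
  for each of them the polynomials whose splitting field is the one generated by the family.
\<close>
theorem card_polys_with_group_le:
  assumes "\<epsilon> > 0"
  shows "\<exists>C>0. \<forall>H\<ge>1. real (card (polys_with_group H G E \<phi>))
    \<le> C * H powr (real (min_faithful_degree G) + 1 + \<epsilon>)"
proof -
  define n where "n = card E"
  define \<mu> where "\<mu> = min_faithful_degree G"
  obtain E' :: "nat set" and \<psi> where E': "finite E'" "card E' = \<mu>" "faithful_action G E' \<psi>"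
    using min_faithful_degree_attained unfolding \<mu>_def by blast
  interpret A: faithful_action G E' \<psi> using E'(3) .
  define a where "a = 2 ^ \<mu> * ((1 + real (\<mu> ^ 3 * n)) ^ n * sqrt (real n + 1))"
  define b where "b = 9 ^ n * sqrt (real n + 1)"
  have a: "a > 0" unfolding a_def by (intro mult_pos_pos zero_less_power) (simp_all add: add_pos_nonneg)
  have b: "b \<ge> 1" unfolding b_def by (intro mult_ge1_I) (simp_all add: one_le_power)
  obtain C where C: "C > 0" "\<And>Y. Y \<ge> 1 \<Longrightarrow> Y * (3 + 2 * ln Y) ^ n \<le> C * Y powr (1 + \<epsilon>)"
    using ln_power_le_powr[OF assms] by blast
  show ?thesis
  proof (intro exI[of _ "(2 * a + 1) ^ \<mu> * (C * b powr (1 + \<epsilon>))"] conjI allI impI)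
    show "(2 * a + 1) ^ \<mu> * (C * b powr (1 + \<epsilon>)) > 0"
      using a b C(1) by (intro mult_pos_pos zero_less_power) simp_all
    fix H :: real assume H: "H \<ge> 1"
    define \<O> where "\<O> = orbits G E' \<psi>"
    define T where "T = (\<Pi>\<^sub>E Q\<in>\<O>. monic_polys (card Q) (a * H))"
    define P where "P = polys_with_group H G E \<phi>"
    define K where "K h = rat_adjoin (\<Union>Q\<in>\<O>. complex_roots (h Q))" for h :: "nat set \<Rightarrow> int poly"
    define F where "F h = {f \<in> P. rat_adjoin (complex_roots f) = K h}" for h
    have cover: "\<Union>\<O> = E'" unfolding \<O>_def by (rule A.orbits_coverture)
    have fin\<O>: "finite \<O>" using cover E'(1) finite_UnionD by blast
    have "(\<Sum>Q\<in>\<O>. card Q) = card E'"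
      using A.disjoint_sum[OF E'(1), of "\<lambda>_. 1 :: nat"] unfolding \<O>_def by simp
    then have sum: "(\<Sum>Q\<in>\<O>. card Q) = \<mu>" using E'(2) by simp
    have finT: "finite T" unfolding T_def using fin\<O> finite_monic_polys by (intro finite_PiE)
    have "real (card T) = (\<Prod>Q\<in>\<O>. real (card (monic_polys (card Q) (a * H))))"
      unfolding T_def using fin\<O> by (simp add: card_PiE)
    also have "\<dots> \<le> (\<Prod>Q\<in>\<O>. (2 * (a * H) + 1) ^ card Q)"
      using a H by (intro prod_mono conjI card_monic_polys_le) simp_all
    also have "\<dots> = (2 * (a * H) + 1) ^ \<mu>" unfolding sum[symmetric] by (rule power_sum[symmetric])
    also have "\<dots> \<le> ((2 * a + 1) * H) ^ \<mu>"
      using a H by (intro power_mono) (simp_all add: algebra_simps)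
    finally have cardT: "real (card T) \<le> (2 * a + 1) ^ \<mu> * H powr \<mu>"
      using H by (simp add: power_mult_distrib powr_realpow)
    have "P \<subseteq> (\<Union>h\<in>T. F h)"
    proof
      fix f assume f: "f \<in> P"
      have aH: "a * H = 2 ^ card E' * ((1 + real (card E' ^ 3 * card E)) ^ card E * (sqrt (real (card E) + 1) * H))"
        by (simp add: a_def E'(2) n_def mult.assoc)
      have "\<exists>h\<in>T. K h = rat_adjoin (complex_roots f)"
        unfolding T_def K_def \<O>_def aH
        by (rule splitting_field_from_orbit_polys[OF E'(3,1) f[unfolded P_def] H])
      then show "f \<in> (\<Union>h\<in>T. F h)" using f unfolding F_def by force
    qed
    moreover have finF: "finite (F h)" for h
      unfolding F_def P_def by (rule finite_subset[OF _ finite_polys_with_group]) blast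
    ultimately have "card P \<le> card (\<Union>h\<in>T. F h)" using finT by (intro card_mono) auto
    also have "\<dots> \<le> (\<Sum>h\<in>T. card (F h))" using finT by (rule card_UN_le)
    finally have "real (card P) \<le> (\<Sum>h\<in>T. real (card (F h)))"
      by (metis of_nat_le_iff of_nat_sum)
    also have "\<dots> \<le> (\<Sum>h\<in>T. C * (b * H) powr (1 + \<epsilon>))"
    proof (rule sum_mono)
      fix h
      let ?F = "{f. regular_galois f \<and> Polynomial.degree f = n \<and> real_of_int (height f) \<le> H \<and>
          rat_adjoin (complex_roots f) = K h}"
      have "?F \<subseteq> monic_polys n H" by (auto simp: monic_polys_def regular_galois.monic)
      then have "finite ?F" using finite_monic_polys finite_subset by blast
      moreover have "F h \<subseteq> ?F"
        unfolding F_def P_def n_def using regular_galois_if_isomorphic(1-3) by blast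
      ultimately have "real (card (F h)) \<le> real (card ?F)" using card_mono by simp
      also have "\<dots> \<le> b * H * (3 + 2 * ln (b * H)) ^ n"
        using card_polys_with_splitting_field[OF H, of n "K h"] by (simp add: b_def mult.assoc)
      also have "\<dots> \<le> C * (b * H) powr (1 + \<epsilon>)"
        using b H by (intro C(2) mult_ge1_I)
      finally show "real (card (F h)) \<le> C * (b * H) powr (1 + \<epsilon>)" .
    qed
    also have "\<dots> = real (card T) * (C * b powr (1 + \<epsilon>) * H powr (1 + \<epsilon>))"
      using b H by (simp add: powr_mult)
    also have "\<dots> \<le> (2 * a + 1) ^ \<mu> * H powr \<mu> * (C * b powr (1 + \<epsilon>) * H powr (1 + \<epsilon>))"
      using cardT C(1) by (intro mult_right_mono) simp_all
    also have "\<dots> = (2 * a + 1) ^ \<mu> * (C * b powr (1 + \<epsilon>)) * H powr (real \<mu> + 1 + \<epsilon>)"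
      by (simp add: powr_add mult_ac)
    finally show "real (card (polys_with_group H G E \<phi>)) \<le>
        (2 * a + 1) ^ \<mu> * (C * b powr (1 + \<epsilon>)) * H powr (real (min_faithful_degree G) + 1 + \<epsilon>)"
      unfolding P_def \<mu>_def .
  qed
qed

end

theorem theorem1p4:
  fixes G :: "('a, 'm) monoid_scheme" and \<Omega> :: "'b set" and \<phi> :: "'a \<Rightarrow> 'b \<Rightarrow> 'b" and \<epsilon> :: real
  assumes "\<epsilon> > 0"
    and "regular_perm_group G \<Omega> \<phi>"
  shows "\<exists>C > 0. \<forall>H \<ge> 1. real (card (polys_with_group H G \<Omega> \<phi>))
           \<le> C * H powr (real (min_faithful_degree G) + 1 + \<epsilon>)"
  using regular_perm_group.card_polys_with_group_le[OF assms(2,1)] .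

end
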